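(* Let $m$ be a square-free positive integer such that the ring of integers $\mathcal{O}_{-m}$ of $\mathbb{Q}(\sqrt{-m})$ has unit group $\{\pm1\}$, and let $\Gamma=\mathrm{PSL}_2(\mathcal{O}_{-m})$. Let $\gamma\in\Gamma$ be an element of order $2$. Then the homeomorphism type of the quotient space $\mathcal{H}^\gamma / C_\Gamma(\gamma)$ is: (i) an edge without identifications (i.e. a compact interval), if $\langle \gamma \rangle$ is contained in a subgroup of $\Gamma$ isomorphic to $\mathbb{Z}/2\times\mathbb{Z}/2$; and (ii) a circle, otherwise.
   Context: $\mathcal{H}=\mathcal{H}^3_{\mathbb{R}}$ is real hyperbolic 3-space, on which $\mathrm{PSL}_2(\mathbb{C})$ acts as the group of orientation preserving isometries. A non-trivial element $\gamma\in\Gamma$ of finite order acts as a rotation around a geodesic line, its rotation axis, which is the fixed point set $\mathcal{H}^\gamma$. $C_\Gamma(\gamma)$ is the centralizer of $\gamma$ in $\Gamma$; it acts on $\mathcal{H}^\gamma$. *)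

theory Defs
  imports
    "HOL-Analysis.Analysis"
    "HOL-Algebra.Group_Action"
    "HOL-Algebra.Multiplicative_Group"
    "HOL-Algebra.Elementary_Groups"
    "HOL-Computational_Algebra.Squarefree"
begin

definition imag_quadratic_field :: "nat \<Rightarrow> complex set" where
  "imag_quadratic_field m = {x + y * csqrt (- of_nat m) | x y. x \<in> \<rat> \<and> y \<in> \<rat>}"

definition ring_of_integers :: "complex set \<Rightarrow> complex set" where
  "ring_of_integers K = {z \<in> K. algebraic_int z}"

definition unit_group :: "complex set \<Rightarrow> complex set" where
  "unit_group R = {u \<in> R. \<exists>v\<in>R. u * v = 1}"

definition SL2 :: "complex set \<Rightarrow> (complex^2^2) monoid" where
  "SL2 R = \<lparr>carrier = {A. (\<forall>i j. A $ i $ j \<in> R) \<and> det A = 1}, monoid.mult = (**), one = mat 1\<rparr>"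

definition PSL2 :: "complex set \<Rightarrow> (complex^2^2) set monoid" where
  "PSL2 R = SL2 R Mod {mat 1, - mat 1}"

definition bianchi_group :: "nat \<Rightarrow> (complex^2^2) set monoid" where
  "bianchi_group m = PSL2 (ring_of_integers (imag_quadratic_field m))"

definition centralizer :: "('a, 'b) monoid_scheme \<Rightarrow> 'a \<Rightarrow> 'a set" where
  "centralizer G a = {x \<in> carrier G. x \<otimes>\<^bsub>G\<^esub> a = a \<otimes>\<^bsub>G\<^esub> x}"

lemma mat2_mult_component:
  fixes A B :: "complex^2^2"
  shows "(A ** B) $ i $ j = A $ i $ 1 * B $ 1 $ j + A $ i $ 2 * B $ 2 $ j"
  by (simp add: matrix_matrix_mult_def sum_2)

lemma mat2_uminus_mult:
  fixes A B :: "complex^2^2"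
  shows "(- A) ** B = - (A ** B)" "A ** (- B) = - (A ** B)"
  by (simp_all add: vec_eq_iff mat2_mult_component)

lemma det_uminus_mat2: "det (- A :: complex^2^2) = det A"
  by (simp add: det_2)

lemma group_SL2:
  assumes 1: "1 \<in> R" and add: "\<And>x y. x \<in> R \<Longrightarrow> y \<in> R \<Longrightarrow> x + y \<in> R"
    and mult: "\<And>x y. x \<in> R \<Longrightarrow> y \<in> R \<Longrightarrow> x * y \<in> R"
    and uminus: "\<And>x. x \<in> R \<Longrightarrow> - x \<in> R"
  shows "group (SL2 R)"
proof (rule groupI)
  have 0: "0 \<in> R"
    using add[OF 1 uminus[OF 1]] by simp
  show "\<one>\<^bsub>SL2 R\<^esub> \<in> carrier (SL2 R)"
    using 0 1 by (auto simp: SL2_def mat_def det_2)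
  fix A B assume A: "A \<in> carrier (SL2 R)" and B: "B \<in> carrier (SL2 R)"
  show "A \<otimes>\<^bsub>SL2 R\<^esub> B \<in> carrier (SL2 R)"
    using A B by (auto simp: SL2_def det_mul mat2_mult_component intro!: add mult)
next
  fix A B C
  show "A \<otimes>\<^bsub>SL2 R\<^esub> B \<otimes>\<^bsub>SL2 R\<^esub> C = A \<otimes>\<^bsub>SL2 R\<^esub> (B \<otimes>\<^bsub>SL2 R\<^esub> C)"
    by (simp add: SL2_def matrix_mul_assoc)
next
  fix A show "\<one>\<^bsub>SL2 R\<^esub> \<otimes>\<^bsub>SL2 R\<^esub> A = A"
    by (simp add: SL2_def)
next
  fix A assume A: "A \<in> carrier (SL2 R)"
  define B :: "complex^2^2" where
    "B = (\<chi> i j. if i = 1 then (if j = 1 then A $ 2 $ 2 else - A $ 1 $ 2)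
                 else (if j = 1 then - A $ 2 $ 1 else A $ 1 $ 1))"
  have "B \<in> carrier (SL2 R)"
    using A by (auto simp: SL2_def B_def det_2 mult.commute intro!: uminus)
  moreover have "B ** A = mat 1"
    using A by (simp add: vec_eq_iff mat2_mult_component forall_2 B_def SL2_def det_2 mat_def
        mult.commute)
  ultimately show "\<exists>B\<in>carrier (SL2 R). B \<otimes>\<^bsub>SL2 R\<^esub> A = \<one>\<^bsub>SL2 R\<^esub>"
    by (auto simp: SL2_def)
qed

lemma normal_pm_one:
  assumes "1 \<in> R" and "\<And>x y. x \<in> R \<Longrightarrow> y \<in> R \<Longrightarrow> x + y \<in> R"
    and "\<And>x y. x \<in> R \<Longrightarrow> y \<in> R \<Longrightarrow> x * y \<in> R"
    and uminus: "\<And>x. x \<in> R \<Longrightarrow> - x \<in> R"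
  shows "{mat 1, - mat 1} \<lhd> SL2 R"
proof -
  interpret group "SL2 R"
    by (rule group_SL2) (use assms in auto)
  have one: "mat 1 \<in> carrier (SL2 R)"
    using one_closed by (simp add: SL2_def)
  have mone: "- mat 1 \<in> carrier (SL2 R)"
    using one uminus by (auto simp: SL2_def det_uminus_mat2)
  have inv: "inv\<^bsub>SL2 R\<^esub> (- mat 1) = - mat 1"
    by (rule inv_equality) (use mone in \<open>auto simp: SL2_def mat2_uminus_mult\<close>)
  have inv1: "inv\<^bsub>SL2 R\<^esub> (mat 1) = mat 1"
    using inv_one by (simp add: SL2_def)
  have "subgroup {mat 1, - mat 1} (SL2 R)"
    by (rule subgroupI)
      (use one mone inv inv1 in \<open>auto simp: mat2_uminus_mult\<close>, auto simp: SL2_def mat2_uminus_mult)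
  moreover have "{mat 1, - mat 1} #>\<^bsub>SL2 R\<^esub> A = A <#\<^bsub>SL2 R\<^esub> {mat 1, - mat 1}" for A
    by (auto simp: r_coset_def l_coset_def SL2_def mat2_uminus_mult)
  ultimately show ?thesis
    by (simp add: normal_def normal_axioms_def is_group)
qed

lemma group_PSL2:
  assumes "1 \<in> R" and "\<And>x y. x \<in> R \<Longrightarrow> y \<in> R \<Longrightarrow> x + y \<in> R"
    and "\<And>x y. x \<in> R \<Longrightarrow> y \<in> R \<Longrightarrow> x * y \<in> R" and "\<And>x. x \<in> R \<Longrightarrow> - x \<in> R"
  shows "group (PSL2 R)"
  unfolding PSL2_def by (rule normal.factorgroup_is_group[OF normal_pm_one]) (use assms in auto)

lemma carrier_PSL2: "carrier (PSL2 R) = {{A, - A} | A. A \<in> carrier (SL2 R)}"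
  by (auto simp: PSL2_def carrier_FactGroup r_coset_def image_def SL2_def mat2_uminus_mult)

definition hyp3 :: "(complex \<times> real) set" where
  "hyp3 = {p. 0 < snd p}"

definition hyp3_dist :: "complex \<times> real \<Rightarrow> complex \<times> real \<Rightarrow> real" where
  \<comment> \<open>The value outside the half-space is irrelevant;
     \<^locale>\<open>Metric_space\<close> asks for symmetry and nonnegativity there as well.\<close>
  "hyp3_dist p q = (if p \<in> hyp3 \<and> q \<in> hyp3
                    then arcosh (1 + (dist p q)\<^sup>2 / (2 * snd p * snd q)) else 0)"

definition hyp3_topology :: "(complex \<times> real) topology" where
  "hyp3_topology = Metric_space.mtopology hyp3 hyp3_dist"

text \<open>
  The Poincare extension of the Moebius transformation \<open>z \<mapsto> (a z + b) / (c z + d)\<close>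
  with \<open>a d - b c = 1\<close>.
\<close>

definition SL2_act :: "complex^2^2 \<Rightarrow> complex \<times> real \<Rightarrow> complex \<times> real" where
  "SL2_act A p =
     (let a = A $ 1 $ 1; b = A $ 1 $ 2; c = A $ 2 $ 1; d = A $ 2 $ 2; z = fst p; r = snd p;
          N = (cmod (c * z + d))\<^sup>2 + (cmod c)\<^sup>2 * r\<^sup>2
      in (((a * z + b) * cnj (c * z + d) + a * cnj c * of_real (r\<^sup>2)) / of_real N, r / N))"

text \<open>An element of \<open>PSL\<^sub>2\<close> is a coset \<open>{A, -A}\<close>; both members act in the same way.\<close>

definition PSL2_act :: "(complex^2^2) set \<Rightarrow> complex \<times> real \<Rightarrow> complex \<times> real" where
  "PSL2_act g = SL2_act (SOME A. A \<in> g)"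

lemma SL2_act_uminus: "SL2_act (- A) = SL2_act A"
proof
  fix p :: "complex \<times> real"
  have "cmod (- (A $ 2 $ 1 * fst p) - A $ 2 $ 2) = cmod (A $ 2 $ 1 * fst p + A $ 2 $ 2)"
    by (simp only: minus_add_distrib[symmetric] diff_conv_add_uminus norm_minus_cancel)
  thus "SL2_act (- A) p = SL2_act A p"
    by (simp add: SL2_act_def Let_def algebra_simps)
qed

lemma PSL2_act_eq:
  assumes "g \<in> carrier (PSL2 R)" "A \<in> g"
  shows "PSL2_act g = SL2_act A"
proof -
  have "(SOME B. B \<in> g) \<in> g"
    using assms(2) by (rule someI)
  moreover obtain C where "g = {C, - C}"
    using assms(1) by (auto simp: carrier_PSL2)
  ultimately show ?thesis
    using assms(2) by (auto simp: PSL2_act_def SL2_act_uminus)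
qed

lemma dist_sq: "(dist p q)\<^sup>2 = (cmod (fst p - fst q))\<^sup>2 + (snd p - snd q)\<^sup>2"
  for p q :: "complex \<times> real"
  by (simp add: dist_prod_def dist_norm dist_real_def)

lemma cosh_hyp3_dist:
  assumes "p \<in> hyp3" "q \<in> hyp3"
  shows "cosh (hyp3_dist p q) = 1 + (dist p q)\<^sup>2 / (2 * snd p * snd q)"
  using assms by (simp add: hyp3_dist_def hyp3_def cosh_arcosh_real)

lemma cosh_hyp3_dist':
  assumes "p \<in> hyp3" "q \<in> hyp3"
  shows "cosh (hyp3_dist p q) =
    ((cmod (fst p - fst q))\<^sup>2 + (snd p)\<^sup>2 + (snd q)\<^sup>2) / (2 * snd p * snd q)"
  using assms unfolding cosh_hyp3_dist[OF assms] dist_sq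
  by (simp add: hyp3_def field_simps power2_eq_square)

lemma hyp3_dist_nonneg: "0 \<le> hyp3_dist p q"
  by (auto simp: hyp3_dist_def hyp3_def intro!: arcosh_nonneg_real)

lemma hyp3_dist_triangle:
  assumes p: "p \<in> hyp3" and o: "o' \<in> hyp3" and q: "q \<in> hyp3"
  shows "hyp3_dist p q \<le> hyp3_dist p o' + hyp3_dist o' q"
proof -
  obtain z r w s u t where [simp]: "p = (z, r)" "q = (w, s)" "o' = (u, t)"
    by (metis surj_pair)
  have pos: "r > 0" "s > 0" "t > 0"
    using assms by (auto simp: hyp3_def)
  define v :: "complex \<Rightarrow> real \<Rightarrow> complex \<times> real" where
    "v = (\<lambda>z r. ((z - u) /\<^sub>R r, ((cmod (z - u))\<^sup>2 + r\<^sup>2 - t\<^sup>2) / (2 * r * t)))"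
  define k where "k = (\<lambda>z r. ((cmod (z - u))\<^sup>2 + r\<^sup>2 + t\<^sup>2) / (2 * r * t))"
  have norm_v: "norm (v z r) = sinh (hyp3_dist (z, r) o')" if "r > 0" for z r
  proof -
    have c: "cosh (hyp3_dist (z, r) o') = k z r"
      using that pos by (subst cosh_hyp3_dist') (auto simp: hyp3_def k_def)
    have "(norm (v z r))\<^sup>2 = (cmod (z - u))\<^sup>2 / r\<^sup>2 + (((cmod (z - u))\<^sup>2 + r\<^sup>2 - t\<^sup>2) / (2 * r * t))\<^sup>2"
    proof -
      have "norm ((z - u) /\<^sub>R r) = cmod (z - u) / r"
        using that by (simp only: norm_scaleR) (simp add: field_simps)
      then show ?thesis
        by (simp only: v_def norm_Pair real_norm_def power2_abs real_sqrt_pow2 sum_power2_ge_zero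
            power_divide[of "cmod (z - u)" r 2, symmetric])
    qed
    also have "\<dots> = (k z r)\<^sup>2 - 1"
      using that pos by (simp add: k_def field_simps power2_eq_square)
    also have "\<dots> = (sinh (hyp3_dist (z, r) o'))\<^sup>2"
      by (simp add: c[symmetric] cosh_square_eq)
    finally show ?thesis
      by (simp add: hyp3_dist_nonneg)
  qed
  have in1: "(cmod (z - w))\<^sup>2 = (cmod (z - u))\<^sup>2 + (cmod (w - u))\<^sup>2 - 2 * inner (z - u) (w - u)"
    by (simp add: power2_norm_eq_inner inner_diff_left inner_diff_right inner_commute)
  have comm: "hyp3_dist o' q = hyp3_dist q o'"
    by (simp add: hyp3_dist_def dist_commute mult.commute mult.left_commute)
  have "cosh (hyp3_dist p q) = ((cmod (z - w))\<^sup>2 + r\<^sup>2 + s\<^sup>2) / (2 * r * s)"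
    using cosh_hyp3_dist'[OF p q] by simp
  also have "\<dots> = k z r * k w s - inner (v z r) (v w s)"
  proof -
    have in2: "inner (v z r) (v w s) = inner (z - u) (w - u) / (r * s) +
        ((cmod (z - u))\<^sup>2 + r\<^sup>2 - t\<^sup>2) / (2 * r * t) * (((cmod (w - u))\<^sup>2 + s\<^sup>2 - t\<^sup>2) / (2 * s * t))"
      unfolding v_def inner_Pair inner_scaleR_left inner_scaleR_right
      by (simp add: divide_simps)
    show ?thesis
      using pos unfolding in1 in2 by (simp add: k_def field_simps power2_eq_square)
  qed
  also have "\<dots> \<le> k z r * k w s + norm (v z r) * norm (v w s)"
    using Cauchy_Schwarz_ineq2[of "v z r" "v w s"] by linarith
  also have "\<dots> = cosh (hyp3_dist p o' + hyp3_dist o' q)"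
  proof -
    have "k z r = cosh (hyp3_dist p o')" "k w s = cosh (hyp3_dist q o')"
      using cosh_hyp3_dist'[OF p o] cosh_hyp3_dist'[OF q o] by (simp_all add: k_def)
    then show ?thesis
      unfolding comm using norm_v[of r z] norm_v[of s w] pos by (simp add: cosh_add)
  qed
  finally show ?thesis
    by (simp add: cosh_real_nonneg_le_iff hyp3_dist_nonneg)
qed

interpretation hyp3: Metric_space hyp3 hyp3_dist
proof
  fix p q
  show "0 \<le> hyp3_dist p q" by (rule hyp3_dist_nonneg)
  show "hyp3_dist p q = hyp3_dist q p"
    by (simp add: hyp3_dist_def dist_commute mult.commute mult.left_commute)
  assume pq: "p \<in> hyp3" "q \<in> hyp3"
  have "hyp3_dist p q = 0 \<longleftrightarrow> cosh (hyp3_dist p q) = 1"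
    by (metis cosh_0 cosh_real_one_iff)
  also have "\<dots> \<longleftrightarrow> p = q"
    using pq by (auto simp: cosh_hyp3_dist hyp3_def)
  finally show "hyp3_dist p q = 0 \<longleftrightarrow> p = q" .
qed (rule hyp3_dist_triangle)

lemma hyp3_topology_eq: "hyp3_topology = top_of_set hyp3"
proof -
  have opn: "open hyp3"
    unfolding hyp3_def by (intro open_Collect_less continuous_intros)
  have "openin (top_of_set hyp3) U" if "openin hyp3_topology U" for U
  proof -
    from that have U: "U \<subseteq> hyp3" "\<And>p. p \<in> U \<Longrightarrow> \<exists>e>0. hyp3.mball p e \<subseteq> U"
      by (auto simp: hyp3_topology_def hyp3.openin_mtopology)
    have "open U"
    proof (subst open_subopen, intro ballI)
      fix p assume p: "p \<in> U"
      then obtain e where e: "e > 0" "hyp3.mball p e \<subseteq> U"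
        using U(2) by blast
      have p': "p \<in> hyp3" using p U(1) by auto
      define W where "W = {q \<in> hyp3. 1 + (dist p q)\<^sup>2 / (2 * snd p * snd q) < cosh e}"
      have "continuous_on hyp3 (\<lambda>q. 1 + (dist p q)\<^sup>2 / (2 * snd p * snd q))"
        using p' by (intro continuous_intros) (auto simp: hyp3_def)
      then have "open W"
        unfolding W_def
        using continuous_on_open_vimage[OF opn, THEN iffD1, rule_format, of _ "{..<cosh e}"]
        by (auto simp: vimage_def Int_def conj_commute)
      moreover have "W = hyp3.mball p e"
      proof -
        have "1 + (dist p q)\<^sup>2 / (2 * snd p * snd q) < cosh e \<longleftrightarrow> hyp3_dist p q < e"
          if "q \<in> hyp3" for q
          unfolding cosh_hyp3_dist[OF p' that, symmetric]
          using e(1) by (simp add: cosh_real_nonneg_less_iff hyp3_dist_nonneg)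
        then show ?thesis
          using p' unfolding W_def hyp3.mball_def by blast
      qed
      ultimately show "\<exists>T. open T \<and> p \<in> T \<and> T \<subseteq> U"
        using e p' by (metis hyp3.centre_in_mball_iff)
    qed
    then show ?thesis
      using U(1) opn by (simp add: openin_open_eq)
  qed
  moreover have "openin hyp3_topology U" if "openin (top_of_set hyp3) U" for U
  proof -
    from that have U: "open U" "U \<subseteq> hyp3"
      using opn by (auto simp: openin_open_eq)
    have "\<exists>\<delta>>0. hyp3.mball p \<delta> \<subseteq> U" if p: "p \<in> U" for p
    proof -
      obtain e where e: "e > 0" "ball p e \<subseteq> U"
        using U(1) p by (auto simp: open_contains_ball)
      define r where "r = snd p"
      have p': "p \<in> hyp3" and r: "r > 0"
        using p U(2) by (auto simp: hyp3_def r_def)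
      define h where "h = min 1 (e\<^sup>2 / (8 * r\<^sup>2)) / 2"
      have h: "h > 0" "h \<le> e\<^sup>2 / (16 * r\<^sup>2)"
        using e r by (auto simp: h_def min_def)
      have h1: "h \<le> 1"
        using min.cobounded1[of 1 "e\<^sup>2 / (8 * r\<^sup>2)"] by (simp add: h_def)
      have "hyp3.mball p (arcosh (1 + h)) \<subseteq> ball p e"
      proof
        fix q assume "q \<in> hyp3.mball p (arcosh (1 + h))"
        then have q: "q \<in> hyp3" and d: "hyp3_dist p q < arcosh (1 + h)" by auto
        define s where "s = snd q"
        have s: "s > 0" using q by (simp add: hyp3_def s_def)
        have "cosh (hyp3_dist p q) < cosh (arcosh (1 + h))"
          using d by (subst cosh_real_nonneg_less_iff) (auto simp: hyp3_dist_nonneg h less_imp_le)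
        then have "(dist p q)\<^sup>2 / (2 * r * s) < h"
          using h by (simp add: cosh_hyp3_dist[OF p' q] cosh_arcosh_real r_def s_def)
        then have *: "(dist p q)\<^sup>2 < 2 * r * s * h"
          using r s by (simp add: field_simps)
        have "(s - r)\<^sup>2 \<le> (dist p q)\<^sup>2"
          by (simp add: dist_sq r_def s_def power2_commute)
        also have "\<dots> \<le> 2 * r * s * 1"
          using order_trans[OF less_imp_le[OF *] mult_left_mono[OF h1, of "2 * r * s"]] r s by simp
        finally have "(s - r)\<^sup>2 \<le> 2 * r * s * 1" .
        moreover have "s * (4 * r) - s * s = (2 * r * s * 1 - (s - r)\<^sup>2) + r * r"
          by (simp add: power2_eq_square algebra_simps)
        ultimately have "s * s \<le> s * (4 * r)"
          using zero_le_square[of r] by linarith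
        then have "s \<le> 4 * r"
          using s by simp
        then have "2 * r * s * h \<le> 2 * r * (4 * r) * h"
          using r h by (intro mult_right_mono mult_left_mono) auto
        also have "\<dots> = 8 * r\<^sup>2 * h"
          by (simp add: power2_eq_square)
        also have "\<dots> \<le> 8 * r\<^sup>2 * (e\<^sup>2 / (16 * r\<^sup>2))"
          using h(2) by (rule mult_left_mono) simp
        also have "\<dots> < e\<^sup>2"
          using r e by simp
        finally have "(dist p q)\<^sup>2 < e\<^sup>2"
          using * by simp
        then show "q \<in> ball p e"
          using e by (simp add: power_less_imp_less_base)
      qed
      moreover have "arcosh (1 + h) > 0"
        using h by simp
      ultimately show ?thesis
        using e by blast
    qed
    then show ?thesis
      using U(2) by (auto simp: hyp3_topology_def hyp3.openin_mtopology)
  qed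
  ultimately show ?thesis
    by (auto simp: topology_eq)
qed

context
  fixes A :: "complex^2^2" and z :: complex and r :: real
begin

definition act_N :: complex where
  "act_N = (A $ 2 $ 1 * z + A $ 2 $ 2) * cnj (A $ 2 $ 1 * z + A $ 2 $ 2)
           + A $ 2 $ 1 * cnj (A $ 2 $ 1) * (of_real r)\<^sup>2"

definition act_P :: complex where
  "act_P = (A $ 1 $ 1 * z + A $ 1 $ 2) * cnj (A $ 2 $ 1 * z + A $ 2 $ 2)
           + A $ 1 $ 1 * cnj (A $ 2 $ 1) * (of_real r)\<^sup>2"

definition act_M :: complex where
  "act_M = (A $ 1 $ 1 * z + A $ 1 $ 2) * cnj (A $ 1 $ 1 * z + A $ 1 $ 2)
           + A $ 1 $ 1 * cnj (A $ 1 $ 1) * (of_real r)\<^sup>2"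

end

lemma act_N_real:
  "act_N A z r = of_real ((cmod (A $ 2 $ 1 * z + A $ 2 $ 2))\<^sup>2 + (cmod (A $ 2 $ 1))\<^sup>2 * r\<^sup>2)"
  by (simp only: act_N_def of_real_add of_real_mult of_real_power[of r 2] complex_norm_square)

lemma act_N_pos:
  fixes A :: "complex^2^2"
  assumes "det A = 1" "r > 0"
  shows "0 < (cmod (A $ 2 $ 1 * z + A $ 2 $ 2))\<^sup>2 + (cmod (A $ 2 $ 1))\<^sup>2 * r\<^sup>2"
proof (cases "A $ 2 $ 1 = 0")
  case True
  then have "A $ 2 $ 2 \<noteq> 0" using assms(1) by (auto simp: det_2)
  then show ?thesis using True by simp
next
  case False
  then show ?thesis using assms(2) by (simp add: add_nonneg_pos)
qed

lemma SL2_act_alt: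
  "SL2_act A (z, r) = (act_P A z r / act_N A z r, r / Re (act_N A z r))"
  by (simp add: SL2_act_def Let_def act_N_real act_P_def del: of_real_add)

lemma SL2_act_in_hyp3: "det A = 1 \<Longrightarrow> p \<in> hyp3 \<Longrightarrow> SL2_act A p \<in> hyp3"
  using act_N_pos[of A "snd p" "fst p"] by (simp add: hyp3_def SL2_act_def Let_def)

lemma SL2_act_one: "SL2_act (mat 1) p = p"
  by (simp add: SL2_act_def Let_def mat_def)

lemma SL2_act_mult:
  assumes A: "det A = 1" and p: "p \<in> hyp3"
  shows "SL2_act (B ** A) p = SL2_act B (SL2_act A p)"
proof -
  obtain z r where pzr: "p = (z, r)" and r: "r > 0"
    using p by (cases p) (auto simp: hyp3_def)
  define N P M where "N = act_N A z r" "P = act_P A z r" "M = act_M A z r"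
  note defs = act_N_def act_P_def act_M_def
  have N_real: "N = of_real (Re N)" and N_pos: "Re N > 0"
    using act_N_pos[OF A r] by (simp_all add: N_P_M_def act_N_real del: of_real_add)
  have N0: "N \<noteq> 0" and cN: "cnj N = N"
    using N_pos by (auto, metis N_real complex_cnj_complex_of_real)
  define w s where "w = P / N" "s = r / Re N"
  have s: "complex_of_real s = of_real r / N"
    using N_real by (metis of_real_divide w_s_def(2))
  have "P * cnj P + of_real r ^ 2 * (det A * cnj (det A)) = M * N"
    unfolding N_P_M_def defs det_2 by (simp add: algebra_simps power2_eq_square)
  then have PP: "P * cnj P + of_real r ^ 2 = M * N"
    by (simp add: A)
  have ws: "w * cnj w + of_real s ^ 2 = M / N"
  proof -
    have "w * cnj w + of_real s ^ 2 = (P * cnj P + of_real r ^ 2) / N ^ 2"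
      by (simp add: w_s_def(1) s cN power2_eq_square add_divide_distrib)
    then show ?thesis
      using N0 unfolding PP by (simp add: power2_eq_square)
  qed
  have gen: "(a * w + b) * cnj (c * w + d) + a * cnj c * of_real s ^ 2
      = (a * cnj c * M + a * cnj d * P + b * cnj c * cnj P + b * cnj d * N) / N" for a b c d
  proof -
    have "(a * w + b) * cnj (c * w + d) + a * cnj c * of_real s ^ 2
      = a * cnj c * (w * cnj w + of_real s ^ 2) + a * cnj d * w + b * cnj c * cnj w + b * cnj d"
      by (simp add: algebra_simps)
    then show ?thesis
      unfolding ws using N0 by (simp add: w_s_def(1) cN field_simps)
  qed
  have NB: "act_N B w s = act_N (B ** A) z r / N"
    unfolding act_N_def[of B w s] gen
    by (simp add: N_P_M_def defs mat2_mult_component algebra_simps)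
  have PB: "act_P B w s = act_P (B ** A) z r / N"
    unfolding act_P_def[of B w s] gen
    by (simp add: N_P_M_def defs mat2_mult_component algebra_simps)
  have ReNB: "Re (act_N B w s) = Re (act_N (B ** A) z r) / Re N"
    unfolding NB by (subst N_real) (simp add: Re_divide_of_real)
  have "SL2_act B (SL2_act A p) = SL2_act B (w, s)"
    by (simp add: pzr SL2_act_alt N_P_M_def w_s_def)
  also have "\<dots> = (act_P B w s / act_N B w s, s / Re (act_N B w s))"
    by (rule SL2_act_alt)
  also have "\<dots> = SL2_act (B ** A) p"
    unfolding ReNB unfolding NB PB pzr SL2_act_alt using N0 N_pos by (simp add: w_s_def(2))
  finally show ?thesis ..
qed

lemma SL2_act_isometry:
  assumes A: "det A = 1" and p: "p \<in> hyp3" and q: "q \<in> hyp3"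
  shows "hyp3_dist (SL2_act A p) (SL2_act A q) = hyp3_dist p q"
proof -
  have form: "of_real (cosh (hyp3_dist p q)) =
      ((fst p * cnj (fst p) + of_real (snd p) ^ 2) + (fst q * cnj (fst q) + of_real (snd q) ^ 2)
        - fst p * cnj (fst q) - cnj (fst p) * fst q) / (2 * of_real (snd p) * of_real (snd q))"
    if "p \<in> hyp3" "q \<in> hyp3" for p q
  proof -
    have "complex_of_real ((cmod (fst p - fst q))\<^sup>2 + (snd p)\<^sup>2 + (snd q)\<^sup>2) =
        (fst p * cnj (fst p) + of_real (snd p) ^ 2) + (fst q * cnj (fst q) + of_real (snd q) ^ 2)
        - fst p * cnj (fst q) - cnj (fst p) * fst q"
      by (simp only: of_real_add complex_norm_square) (simp add: algebra_simps)
    then show ?thesis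
      unfolding cosh_hyp3_dist'[OF that]
      by (simp only: of_real_divide of_real_mult of_real_numeral)
  qed
  obtain z r w s where pq: "p = (z, r)" "q = (w, s)" and rs: "r > 0" "s > 0"
    using p q by (cases p; cases q) (auto simp: hyp3_def)
  note defs = act_N_def act_P_def act_M_def
  have PP: "act_P A z r * cnj (act_P A z r) + of_real r ^ 2 = act_M A z r * act_N A z r" for z r
  proof -
    have "act_P A z r * cnj (act_P A z r) + of_real r ^ 2 * (det A * cnj (det A))
        = act_M A z r * act_N A z r"
      unfolding defs det_2 by (simp add: algebra_simps power2_eq_square)
    then show ?thesis by (simp add: A)
  qed
  define N P M where "N = act_N A z r" "P = act_P A z r" "M = act_M A z r"
  define N' P' M' where "N' = act_N A w s" "P' = act_P A w s" "M' = act_M A w s"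
  have N_real: "of_real (Re N) = N" "of_real (Re N') = N'" and N_pos: "Re N > 0" "Re N' > 0"
    using act_N_pos[OF A rs(1)] act_N_pos[OF A rs(2)]
    by (simp_all add: N_P_M_def N'_P'_M'_def act_N_real del: of_real_add)
  have N0: "N \<noteq> 0" "N' \<noteq> 0" and cN: "cnj N = N" "cnj N' = N'"
    using N_pos by (auto, metis N_real(1) complex_cnj_complex_of_real,
      metis N_real(2) complex_cnj_complex_of_real)
  have m1: "P / N * cnj (P / N) + (of_real r / N) ^ 2 = M / N"
  proof -
    have "P / N * cnj (P / N) + (of_real r / N) ^ 2 = (P * cnj P + of_real r ^ 2) / N ^ 2"
      by (simp add: cN power2_eq_square add_divide_distrib)
    then show ?thesis
      using N0 unfolding PP[of z r, folded N_P_M_def] by (simp add: power2_eq_square)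
  qed
  have m2: "P' / N' * cnj (P' / N') + (of_real s / N') ^ 2 = M' / N'"
  proof -
    have "P' / N' * cnj (P' / N') + (of_real s / N') ^ 2 = (P' * cnj P' + of_real s ^ 2) / N' ^ 2"
      by (simp add: cN power2_eq_square add_divide_distrib)
    then show ?thesis
      using N0 unfolding PP[of w s, folded N'_P'_M'_def] by (simp add: power2_eq_square)
  qed
  have "M * N' + M' * N - P * cnj P' - cnj P * P' = (det A * cnj (det A)) *
     ((z * cnj z + of_real r ^ 2) + (w * cnj w + of_real s ^ 2) - z * cnj w - cnj z * w)"
    unfolding N_P_M_def N'_P'_M'_def defs det_2 by (simp add: algebra_simps power2_eq_square)
  then have inv: "M * N' + M' * N - P * cnj P' - cnj P * P' =
     (z * cnj z + of_real r ^ 2) + (w * cnj w + of_real s ^ 2) - z * cnj w - cnj z * w"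
    by (simp add: A)
  have act: "SL2_act A p = (P / N, r / Re N)" "SL2_act A q = (P' / N', s / Re N')"
    by (simp_all add: pq SL2_act_alt N_P_M_def N'_P'_M'_def)
  have "complex_of_real (cosh (hyp3_dist (SL2_act A p) (SL2_act A q))) =
      (M / N + M' / N' - P / N * cnj (P' / N') - cnj (P / N) * (P' / N'))
        / (2 * (of_real r / N) * (of_real s / N'))"
    unfolding act
      form[OF SL2_act_in_hyp3[OF A p, unfolded act(1)] SL2_act_in_hyp3[OF A q, unfolded act(2)]]
      fst_conv snd_conv of_real_divide N_real m1 m2 by (rule refl)
  also have "\<dots> = (M * N' + M' * N - P * cnj P' - cnj P * P') / (2 * of_real r * of_real s)"
  proof -
    have "M / N + M' / N' - P / N * cnj (P' / N') - cnj (P / N) * (P' / N')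
        = (M * N' + M' * N - P * cnj P' - cnj P * P') / (N * N')"
      using N0 by (simp add: cN add_divide_distrib diff_divide_distrib)
    then show ?thesis
      using N0 by simp
  qed
  also have "\<dots> = of_real (cosh (hyp3_dist p q))"
    unfolding inv by (subst form[OF p q]) (simp add: pq)
  finally have "cosh (hyp3_dist (SL2_act A p) (SL2_act A q)) = cosh (hyp3_dist p q)"
    by (simp only: of_real_eq_iff)
  then show ?thesis
    by (metis arcosh_cosh_real hyp3_dist_nonneg)
qed

definition quotient_topology :: "'a topology \<Rightarrow> ('a \<Rightarrow> 'b) \<Rightarrow> 'b topology" where
  "quotient_topology X f =
     topology (\<lambda>U. U \<subseteq> f ` topspace X \<and> openin X {x \<in> topspace X. f x \<in> U})"

lemma openin_quotient_topology:
  "openin (quotient_topology X f) U \<longleftrightarrow>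
     U \<subseteq> f ` topspace X \<and> openin X {x \<in> topspace X. f x \<in> U}"
proof -
  have Int: "{x \<in> topspace X. f x \<in> S \<inter> T}
      = {x \<in> topspace X. f x \<in> S} \<inter> {x \<in> topspace X. f x \<in> T}" for S T
    by auto
  have Un: "{x \<in> topspace X. f x \<in> \<Union>\<K>} = (\<Union>K\<in>\<K>. {x \<in> topspace X. f x \<in> K})" for \<K>
    by auto
  have "istopology (\<lambda>U. U \<subseteq> f ` topspace X \<and> openin X {x \<in> topspace X. f x \<in> U})"
    unfolding istopology_def
  proof (intro conjI allI impI)
    fix S T
    assume S: "S \<subseteq> f ` topspace X \<and> openin X {x \<in> topspace X. f x \<in> S}"
      and T: "T \<subseteq> f ` topspace X \<and> openin X {x \<in> topspace X. f x \<in> T}"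
    show "S \<inter> T \<subseteq> f ` topspace X"
      using S by blast
    show "openin X {x \<in> topspace X. f x \<in> S \<inter> T}"
      unfolding Int by (rule openin_Int[OF conjunct2[OF S] conjunct2[OF T]])
  next
    fix \<K>
    assume K: "\<forall>K\<in>\<K>. K \<subseteq> f ` topspace X \<and> openin X {x \<in> topspace X. f x \<in> K}"
    show "\<Union>\<K> \<subseteq> f ` topspace X"
      using K by (intro Union_least) blast
    show "openin X {x \<in> topspace X. f x \<in> \<Union>\<K>}"
      unfolding Un by (rule openin_Union) (use K in fast)
  qed
  then show ?thesis
    unfolding quotient_topology_def by (simp only: topology_inverse')
qed

lemma topspace_quotient_topology: "topspace (quotient_topology X f) = f ` topspace X"
proof -
  have "{x \<in> topspace X. f x \<in> f ` topspace X} = topspace X"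
    by auto
  then have "openin (quotient_topology X f) (f ` topspace X)"
    by (simp add: openin_quotient_topology)
  then have "f ` topspace X \<subseteq> topspace (quotient_topology X f)"
    by (rule openin_subset)
  moreover have "topspace (quotient_topology X f) \<subseteq> f ` topspace X"
    using openin_topspace[of "quotient_topology X f"] 
    by (simp only: openin_quotient_topology)
  ultimately show ?thesis
    by (rule subset_antisym[rotated])
qed

lemma quotient_map_quotient_topology: "quotient_map X (quotient_topology X f) f"
  by (simp add: quotient_map_def topspace_quotient_topology openin_quotient_topology)

definition orbit_space ::
    "'b topology \<Rightarrow> ('a, 'c) monoid_scheme \<Rightarrow> ('a \<Rightarrow> 'b \<Rightarrow> 'b) \<Rightarrow> 'b set topology" where
  "orbit_space X G \<phi> = quotient_topology X (orbit G \<phi>)"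

definition axis_quotient ::
    "(complex^2^2) set monoid \<Rightarrow> (complex^2^2) set \<Rightarrow> (complex \<times> real) set topology" where
  "axis_quotient \<Gamma> \<gamma> =
     orbit_space (subtopology hyp3_topology (invariants hyp3 PSL2_act \<gamma>))
       (\<Gamma>\<lparr>carrier := centralizer \<Gamma> \<gamma>\<rparr>) PSL2_act"

end

theory Submission
  imports Defs
begin

text \<open>
  Lift \<open>\<gamma>\<close> to a matrix \<open>A\<close> with \<open>A\<^sup>2 = -1\<close>. Since \<open>\<i>\<close> is not an integer of the field,
  the lower left entry of \<open>A\<close> is nonzero and a complex matrix conjugates \<open>A\<close> to
  \<open>diag(\<i>, -\<i>)\<close>, which moves the rotation axis to the vertical line over \<open>0\<close>. A matrix \<open>B\<close>
  represents an element of the centralizer iff \<open>B A = A B\<close> or \<open>B A = - A B\<close>. In the coordinate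
  \<open>s = ln r\<close> of the line, commuting matrices (conjugate to \<open>diag(t, 1/t)\<close>) act by the
  translations \<open>s \<mapsto> s + 2 ln \<bar>t\<bar>\<close> and anticommuting ones by reflections. The translation
  lengths form a lattice in the reals: it is discrete because \<open>t + 1/t\<close> is an integer of the
  field, and it is nonzero because of the solvability of Pell's equation. So the quotient is a
  circle if there are only translations, and a segment if there are reflections. Anticommuting
  matrices have square \<open>-1\<close>, hence they exist exactly if \<open>\<gamma>\<close> lies in a Klein four-group.
\<close>

section \<open>Integers of imaginary quadratic fields\<close>

lemma map_poly_of_int_add:
  "map_poly of_int (p + q) = (map_poly of_int p + map_poly of_int q :: 'a :: comm_ring_1 poly)"
  by (intro poly_eqI) (simp add: coeff_map_poly)

lemma map_poly_of_int_mult: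
  "map_poly of_int (p * q) = (map_poly of_int p * map_poly of_int q :: 'a :: comm_ring_1 poly)"
  by (intro poly_eqI) (simp add: coeff_map_poly coeff_mult)

text \<open>A form of Gauss's lemma. Pseudo-division of a monic integer polynomial \<open>f\<close>
  with root \<open>z\<close> by \<open>g\<close> leaves a remainder of degree at most 1 that
  vanishes at the non-real \<open>z\<close>, hence is zero. In \<open>k f = g q\<close> the
  primitivity of \<open>g\<close> gives \<open>q\<close> the content of \<open>k\<close>; cancelling
  \<open>k\<close> exhibits \<open>f\<close> as an integer multiple of \<open>g\<close>, and
  \<open>f\<close> is monic.\<close>

lemma primitive_quadratic_lead_coeff:
  fixes z :: complex and g :: "int poly"
  assumes z: "algebraic_int z" "z \<notin> \<real>"
    and g: "degree g = 2" "content g = 1" "poly (map_poly of_int g) z = 0"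
  shows "\<bar>lead_coeff g\<bar> = 1"
proof -
  obtain f :: "int poly" where f: "poly (map_poly of_int f) z = 0" "lead_coeff f = 1"
    using z(1) by (auto simp: algebraic_int_altdef_ipoly)
  obtain q r where qr: "pseudo_divmod f g = (q, r)"
    by (cases "pseudo_divmod f g") auto
  define k where "k = lead_coeff g ^ (Suc (degree f) - degree g)"
  have g0: "g \<noteq> 0" using g(1) by auto
  have eq: "Polynomial.smult k f = g * q + r" and r: "degree r \<le> 1"
    using pseudo_divmod[OF g0 qr] g(1) by (auto simp: k_def)
  have "poly (map_poly of_int r) z = 0"
  proof -
    have "poly (map_poly of_int (Polynomial.smult k f)) z = poly (map_poly of_int (g * q + r)) z"
      by (simp only: eq)
    then show ?thesis
      using f(1) g(3) by (simp add: map_poly_of_int_add map_poly_of_int_mult map_poly_smult)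
  qed
  moreover have "r = [:poly.coeff r 0, poly.coeff r 1:]"
    using r by (intro poly_eqI) (auto simp: coeff_pCons coeff_eq_0 split: nat.splits)
  then obtain c d where cd: "r = [:c, d:]" by blast
  ultimately have e: "of_int c + z * of_int d = 0"
    by (simp add: map_poly_pCons)
  have "Im z \<noteq> 0" using z(2) by (simp add: complex_is_Real_iff)
  then have "d = 0" using arg_cong[OF e, of Im] by simp
  then have "r = 0" using e cd by simp
  then have eq: "Polynomial.smult k f = g * q" using eq by simp
  have "content f = 1"
    using f(2) content_dvd_coeff[of f "degree f"] normalize_content[of f] by simp
  then have "content q = \<bar>k\<bar>"
    using arg_cong[OF eq, of content] g(2) by (simp add: content_mult)
  then obtain q' where q': "q = Polynomial.smult k q'"
    by (metis content_dvd const_poly_dvd_iff_dvd_content abs_dvd_iff dvd_refl smult_dvd_cancel dvdE mult_pCons_left mult_zero_left add.right_neutral pCons_0_0)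
  have "k \<noteq> 0" using g0 by (simp add: k_def)
  then have "f = g * q'"
    using eq unfolding q' mult_smult_right by (intro poly_eqI) (metis coeff_smult mult_cancel_left)
  then have "lead_coeff g dvd 1"
    using f(2) by (metis dvd_triv_left lead_coeff_mult)
  then show ?thesis by simp
qed

text \<open>Trace and norm of \<open>z\<close> are, up to sign, coefficients of the primitive
  integer polynomial proportional to its characteristic polynomial, because the leading coefficient
  of that polynomial is a unit.\<close>

lemma quadratic_trace_norm:
  fixes z :: complex
  assumes z: "algebraic_int z" "z \<notin> \<real>" and rat: "2 * Re z \<in> \<rat>" "(cmod z)\<^sup>2 \<in> \<rat>"
  shows "2 * Re z \<in> \<int>" "(cmod z)\<^sup>2 \<in> \<int>"
proof -
  obtain a b where ab: "2 * Re z = of_int a / of_int b" "b > 0"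
    using rat(1) by (meson Rats_cases')
  obtain c d where cd: "(cmod z)\<^sup>2 = of_int c / of_int d" "d > 0"
    using rat(2) by (meson Rats_cases')
  have char: "z\<^sup>2 - of_real (2 * Re z) * z + of_real ((cmod z)\<^sup>2) = 0"
    unfolding complex_norm_square complex_add_cnj[symmetric] by (simp add: algebra_simps power2_eq_square)
  \<comment> \<open>The characteristic polynomial of \<open>z\<close>, with trace
    \<open>a / b\<close> and norm \<open>c / d\<close>, multiplied by \<open>b * d\<close>.\<close>
  define G where "G = [:b * c, - a * d, b * d:]"
  have degG: "degree G = 2" using ab cd by (simp add: G_def)
  then have G0: "G \<noteq> 0" by auto
  have "poly (map_poly of_int G) z = of_int (b * d) * (z\<^sup>2 - of_real (2 * Re z) * z + of_real ((cmod z)\<^sup>2))"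
    using ab(2) cd(2) unfolding ab cd G_def
    by (simp add: map_poly_pCons field_simps power2_eq_square)
  then have "poly (map_poly of_int G) z = 0" using char by simp
  define g where "g = primitive_part G"
  have G: "G = Polynomial.smult (content G) g" by (simp add: g_def)
  have root: "poly (map_poly of_int g) z = 0"
  proof -
    have "poly (map_poly of_int G) z = of_int (content G) * poly (map_poly of_int g) z"
      by (subst G) (simp add: map_poly_smult)
    then show ?thesis using \<open>poly (map_poly of_int G) z = 0\<close> G0 by simp
  qed
  have deg: "degree g = 2" using degG by (simp add: g_def)
  have "\<bar>lead_coeff g\<bar> = 1"
    by (rule primitive_quadratic_lead_coeff[OF z deg _ root]) (use G0 in \<open>simp add: g_def\<close>)
  then have u: "\<bar>poly.coeff g 2\<bar> = 1" using deg by simp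
  have "poly.coeff G i = content G * poly.coeff g i" for i
    by (subst G) simp
  from this[of 0] this[of 1] this[of 2]
  have co: "b * c = content G * poly.coeff g 0" "- a * d = content G * poly.coeff g 1" "b * d = content G * poly.coeff g 2"
    by (simp_all add: G_def numeral_2_eq_2)
  have "poly.coeff g 2 = 1 \<or> poly.coeff g 2 = -1" using u by linarith
  \<comment> \<open>Since the primitive part has leading coefficient 1 or -1, the content absorbs
    the whole leading coefficient \<open>b * d\<close>; dividing the other coefficients by it leaves
    integers.\<close>
  then have cG: "content G = b * d \<or> content G = - b * d"
    using co(3) by auto
  have bd: "real_of_int (b * d) \<noteq> 0" using ab cd by simp
  have "2 * Re z = of_int (a * d) / of_int (b * d)" using ab cd by simp
  also have "\<dots> = of_int (poly.coeff g 1) \<or> \<dots> = of_int (- poly.coeff g 1)"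
  proof -
    have "a * d = b * d * poly.coeff g 1 \<or> a * d = b * d * (- poly.coeff g 1)"
      using co(2) cG by auto
    then show ?thesis using bd by (metis nonzero_mult_div_cancel_left of_int_mult)
  qed
  finally show "2 * Re z \<in> \<int>" by auto
  have "(cmod z)\<^sup>2 = of_int (b * c) / of_int (b * d)" using ab cd by simp
  also have "\<dots> = of_int (poly.coeff g 0) \<or> \<dots> = of_int (- poly.coeff g 0)"
  proof -
    have "b * c = b * d * poly.coeff g 0 \<or> b * c = b * d * (- poly.coeff g 0)"
      using co(1) cG by auto
    then show ?thesis using bd by (metis nonzero_mult_div_cancel_left of_int_mult)
  qed
  finally show "(cmod z)\<^sup>2 \<in> \<int>" by auto
qed

lemma imag_quadratic_field_Complex:
  "imag_quadratic_field m = {Complex p (q * sqrt m) | p q. p \<in> \<rat> \<and> q \<in> \<rat>}"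
proof -
  have "csqrt (- of_nat m) = \<i> * of_real (sqrt m)"
    by simp
  then have eq: "of_real p + of_real q * csqrt (- of_nat m) = Complex p (q * sqrt m)" for p q
    by (simp add: complex_eq_iff)
  have "of_rat r = (of_real (of_rat r) :: complex)" for r
    by (cases r) (simp add: of_rat_rat)
  then have rat: "x \<in> \<rat> \<longleftrightarrow> (\<exists>p\<in>\<rat>. x = of_real p)" for x :: complex
    by (metis Rats_cases Rats_of_rat)
  show ?thesis
    unfolding imag_quadratic_field_def rat
    using eq by (auto; metis)
qed

text \<open>The two integrality conditions below are those on the trace \<open>a\<close> and the norm
  \<open>(a\<^sup>2 + m b\<^sup>2) / 4\<close>; they avoid the case distinction on \<open>m mod 4\<close>.\<close>

lemma mem_ring_of_integers_iff:
  assumes "squarefree m"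
  shows "z \<in> ring_of_integers (imag_quadratic_field m) \<longleftrightarrow>
    (\<exists>a b :: int. z = Complex (a / 2) (b * sqrt m / 2) \<and> 4 dvd a\<^sup>2 + int m * b\<^sup>2)"
proof
  have m: "m > 0" using assms by (cases m) auto
  assume z: "z \<in> ring_of_integers (imag_quadratic_field m)"
  then obtain p q where pq: "p \<in> \<rat>" "q \<in> \<rat>" "z = Complex p (q * sqrt m)" and int: "algebraic_int z"
    by (auto simp: ring_of_integers_def imag_quadratic_field_Complex)
  show "\<exists>a b :: int. z = Complex (a / 2) (b * sqrt m / 2) \<and> 4 dvd a\<^sup>2 + int m * b\<^sup>2"
  proof (cases "q = 0")
    case True
    then have "z = of_real p" using pq by (simp add: complex_eq_iff)
    then have "p \<in> \<int>" using pq int rational_algebraic_int_is_int by auto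
    then obtain n where "p = of_int n" by (auto elim: Ints_cases)
    then show ?thesis using pq True by (intro exI[of _ "2 * n"] exI[of _ 0]) auto
  next
    case False
    then have "z \<notin> \<real>" using m pq by (simp add: complex_is_Real_iff)
    moreover have norm: "(cmod z)\<^sup>2 = p\<^sup>2 + real m * q\<^sup>2"
      using pq by (simp add: cmod_power2 power_mult_distrib mult.commute)
    moreover have "2 * Re z \<in> \<rat>" "(cmod z)\<^sup>2 \<in> \<rat>"
      using pq norm by auto
    ultimately have "2 * Re z \<in> \<int>" "(cmod z)\<^sup>2 \<in> \<int>"
      using quadratic_trace_norm int by blast+
    then obtain a n :: int where a: "2 * p = a" and n: "p\<^sup>2 + real m * q\<^sup>2 = n"
      using pq norm by (auto elim!: Ints_cases)
    obtain u v where uv: "2 * q = of_int u / of_int v" "v > 0" "coprime u v"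
      using pq(2) by (metis Rats_cases' Rats_mult Rats_number_of)
    \<comment> \<open>The norm condition makes \<open>m * (2 * q)^2\<close> an integer. With
      \<open>2 * q = u / v\<close> in lowest terms this gives \<open>v^2\<close> dividing
      \<open>m * u^2\<close>, hence \<open>m\<close>, and squarefreeness forces
      \<open>v = 1\<close>.\<close>
    have "real m * (2 * q)\<^sup>2 = 4 * real_of_int n - (real_of_int a)\<^sup>2"
      unfolding a[symmetric] n[symmetric] by (simp add: power_mult_distrib)
    then have "real_of_int (int m * u\<^sup>2) = real_of_int ((4 * n - a\<^sup>2) * v\<^sup>2)"
      using uv(2) unfolding uv(1) by (simp add: power_divide field_simps)
    then have "int m * u\<^sup>2 = (4 * n - a\<^sup>2) * v\<^sup>2"
      by (simp only: of_int_eq_iff)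
    then have "v\<^sup>2 dvd int m * u\<^sup>2" by simp
    then have "v\<^sup>2 dvd int m"
      using uv(3) by (metis coprime_commute coprime_dvd_mult_left_iff coprime_power_left_iff coprime_power_right_iff)
    then have "(nat v)\<^sup>2 dvd m"
      using uv(2) by (metis int_dvd_int_iff nat_0_le of_nat_power order_less_imp_le)
    then have "nat v dvd 1" using assms unfolding squarefree_def by blast
    then have "v = 1" using uv(2) by simp
    then have b: "2 * q = u" using uv by simp
    have "real_of_int (a\<^sup>2 + int m * u\<^sup>2) = real_of_int (4 * n)"
      using n unfolding of_int_add of_int_mult of_int_power a[symmetric] b[symmetric]
      by (simp add: power_mult_distrib)
    then have "a\<^sup>2 + int m * u\<^sup>2 = 4 * n"
      by (simp only: of_int_eq_iff)
    then show ?thesis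
      using a b pq by (intro exI[of _ a] exI[of _ u]) (auto simp flip: a b)
  qed
next
  assume "\<exists>a b :: int. z = Complex (a / 2) (b * sqrt m / 2) \<and> 4 dvd a\<^sup>2 + int m * b\<^sup>2"
  then obtain a b n :: int where z: "z = Complex (a / 2) (b * sqrt m / 2)" and n: "a\<^sup>2 + int m * b\<^sup>2 = 4 * n"
    by (auto elim!: dvdE)
  have "4 * real_of_int n = (real_of_int a)\<^sup>2 + real m * (real_of_int b)\<^sup>2"
    using arg_cong[OF n, of real_of_int] by simp
  then have norm: "(cmod z)\<^sup>2 = n"
    unfolding z cmod_power2 by (simp add: power_divide power_mult_distrib mult.commute)
  have char: "z\<^sup>2 - of_real (2 * Re z) * z + of_real ((cmod z)\<^sup>2) = 0"
    unfolding complex_norm_square complex_add_cnj[symmetric] by (simp add: algebra_simps power2_eq_square)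
  have "algebraic_int z"
  proof (rule algebraic_int.intros)
    let ?p = "[:of_int n, - of_int a, 1:] :: complex poly"
    show "lead_coeff ?p = 1" by simp
    show "\<forall>i. poly.coeff ?p i \<in> \<int>"
      by (auto simp: coeff_pCons split: nat.splits)
    show "poly ?p z = 0"
      using char unfolding norm by (simp add: z algebra_simps power2_eq_square)
  qed
  moreover have "z \<in> imag_quadratic_field m"
    unfolding imag_quadratic_field_Complex z
    by (intro CollectI exI[of _ "of_int a / 2"] exI[of _ "of_int b / 2"]) auto
  ultimately show "z \<in> ring_of_integers (imag_quadratic_field m)"
    by (simp add: ring_of_integers_def)
qed

section \<open>Ring operations and discreteness of the integers of the field\<close>

context
  fixes m :: nat and R :: "complex set"
  assumes sqf: "squarefree m" and R: "R = ring_of_integers (imag_quadratic_field m)"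
begin

text \<open>A number and its square have the same parity. Thus \<open>a\<close> and
  \<open>m * b\<close> agree modulo 2, which is what makes the cross terms in sums and products
  even.\<close>

lemma ring_of_integers_parity:
  assumes "4 dvd (a :: int)\<^sup>2 + int m * b\<^sup>2"
  shows "even (a + int m * b)"
proof -
  have "even (a\<^sup>2 + int m * b\<^sup>2)"
    using assms by (rule dvd_trans[rotated]) simp
  then show ?thesis by auto
qed

lemma ring_of_integers_of_int: "of_int n \<in> R"
  unfolding R mem_ring_of_integers_iff[OF sqf]
  by (intro exI[of _ "2 * n"] exI[of _ 0]) (auto simp: complex_eq_iff)

lemma ring_of_integers_sqrt: "of_int n * (\<i> * of_real (sqrt m)) \<in> R"
  unfolding R mem_ring_of_integers_iff[OF sqf]
  by (intro exI[of _ 0] exI[of _ "2 * n"]) (auto simp: complex_eq_iff)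

lemma ring_of_integers_uminus: "x \<in> R \<Longrightarrow> - x \<in> R"
  unfolding R mem_ring_of_integers_iff[OF sqf]
  by (elim exE conjE, rule_tac x = "- a" in exI, rule_tac x = "- b" in exI)
     (simp add: complex_eq_iff)

lemma ring_of_integers_add:
  assumes "x \<in> R" "y \<in> R"
  shows "x + y \<in> R"
proof -
  obtain a b where x: "x = Complex (a / 2) (b * sqrt m / 2)" and ab: "4 dvd a\<^sup>2 + int m * b\<^sup>2"
    using assms(1) by (auto simp: R mem_ring_of_integers_iff[OF sqf])
  obtain c d where y: "y = Complex (c / 2) (d * sqrt m / 2)" and cd: "4 dvd c\<^sup>2 + int m * d\<^sup>2"
    using assms(2) by (auto simp: R mem_ring_of_integers_iff[OF sqf])
  have "even (a + int m * b)" "even (c + int m * d)"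
    using ring_of_integers_parity[OF ab] ring_of_integers_parity[OF cd] by blast+
  \<comment> \<open>Modulo 2, \<open>a * c\<close> equals \<open>m * b * m * d\<close>, which is
    \<open>m * b * d\<close>. Twice this even number is the cross term in the norm form of the
    sum.\<close>
  then have "even (a * c + int m * b * d)" by auto
  then have "4 dvd 2 * (a * c + int m * b * d)"
    using mult_dvd_mono[of 2 2 2 "a * c + int m * b * d"] by simp
  then have "4 dvd (a\<^sup>2 + int m * b\<^sup>2) + (c\<^sup>2 + int m * d\<^sup>2) + 2 * (a * c + int m * b * d)"
    by (rule dvd_add[OF dvd_add[OF ab cd]])
  then have "4 dvd (a + c)\<^sup>2 + int m * (b + d)\<^sup>2"
    by (simp add: power2_eq_square algebra_simps)
  moreover have "x + y = Complex (of_int (a + c) / 2) (of_int (b + d) * sqrt m / 2)"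
    by (simp add: x y complex_eq_iff field_simps)
  ultimately show ?thesis
    unfolding R mem_ring_of_integers_iff[OF sqf] by blast
qed

text \<open>The norm form is multiplicative by Brahmagupta's identity. Parity lets a factor 2 be
  taken out of both coordinates of the product, and the divisibility of the product of the forms by
  16 then leaves the required factor 4.\<close>

lemma ring_of_integers_mult:
  assumes "x \<in> R" "y \<in> R"
  shows "x * y \<in> R"
proof -
  obtain a b where x: "x = Complex (a / 2) (b * sqrt m / 2)" and ab: "4 dvd a\<^sup>2 + int m * b\<^sup>2"
    using assms(1) by (auto simp: R mem_ring_of_integers_iff[OF sqf])
  obtain c d where y: "y = Complex (c / 2) (d * sqrt m / 2)" and cd: "4 dvd c\<^sup>2 + int m * d\<^sup>2"
    using assms(2) by (auto simp: R mem_ring_of_integers_iff[OF sqf])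
  have par: "even (a + int m * b)" "even (c + int m * d)"
    using ring_of_integers_parity[OF ab] ring_of_integers_parity[OF cd] by blast+
  then have "even (a * c - int m * b * d)" "even (a * d + b * c)" by auto
  then obtain e f where ef: "a * c - int m * b * d = 2 * e" "a * d + b * c = 2 * f"
    by (metis evenE)
  have "(a\<^sup>2 + int m * b\<^sup>2) * (c\<^sup>2 + int m * d\<^sup>2) = (2 * e)\<^sup>2 + int m * (2 * f)\<^sup>2"
    unfolding ef[symmetric] by (simp add: power2_eq_square algebra_simps)
  also have "\<dots> = 4 * (e\<^sup>2 + int m * f\<^sup>2)"
    by (simp add: power_mult_distrib algebra_simps)
  finally have "(a\<^sup>2 + int m * b\<^sup>2) * (c\<^sup>2 + int m * d\<^sup>2) = 4 * (e\<^sup>2 + int m * f\<^sup>2)" .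
  moreover have "4 * 4 dvd (a\<^sup>2 + int m * b\<^sup>2) * (c\<^sup>2 + int m * d\<^sup>2)"
    using ab cd by (rule mult_dvd_mono)
  ultimately have "4 dvd e\<^sup>2 + int m * f\<^sup>2"
    by (metis dvd_mult_cancel_left zero_neq_numeral)
  moreover have "x * y = Complex (e / 2) (f * sqrt m / 2)"
  proof -
    have "x * y = Complex ((a * c - real m * b * d) / 4) ((a * d + b * c) * sqrt m / 4)"
      by (simp add: x y complex_eq_iff field_simps)
    moreover have "a * c - real m * b * d = 2 * real_of_int e" "real_of_int a * d + b * c = 2 * real_of_int f"
      using arg_cong[OF ef(1), of real_of_int] arg_cong[OF ef(2), of real_of_int] by simp_all
    ultimately show ?thesis by simp
  qed
  ultimately show ?thesis
    unfolding R mem_ring_of_integers_iff[OF sqf] by blast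
qed

text \<open>Bounds on the real and imaginary parts bound both integer coordinates, since
  \<open>sqrt m\<close> is at least 1.\<close>

lemma finite_ring_of_integers_bounded: "finite {z \<in> R. cmod z \<le> C}"
proof -
  have m: "m > 0" using sqf by (cases m) auto
  have "a \<in> {\<lfloor>- 2 * C\<rfloor>..\<lceil>2 * C\<rceil>} \<and> b \<in> {\<lfloor>- 2 * C\<rfloor>..\<lceil>2 * C\<rceil>}"
    if "cmod (Complex (of_int a / 2) (of_int b * sqrt m / 2)) \<le> C" for a b :: int
  proof -
    have "\<bar>of_int a / 2\<bar> \<le> C" "\<bar>of_int b * sqrt m / 2\<bar> \<le> C"
      using that abs_Re_le_cmod[of "Complex (of_int a / 2) (of_int b * sqrt m / 2)"]
        abs_Im_le_cmod[of "Complex (of_int a / 2) (of_int b * sqrt m / 2)"] by auto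
    moreover have "\<bar>of_int b\<bar> \<le> \<bar>of_int b * sqrt m\<bar>"
      using m by (auto simp: abs_mult intro!: mult_le_cancel_left1[THEN iffD2])
    ultimately have "\<bar>of_int a\<bar> \<le> 2 * C" "\<bar>of_int b\<bar> \<le> 2 * C" by linarith+
    then show ?thesis by (simp; linarith)
  qed
  then have "{z \<in> R. cmod z \<le> C} \<subseteq> (\<lambda>(a, b). Complex (of_int a / 2) (of_int b * sqrt m / 2)) `
      ({\<lfloor>- 2 * C\<rfloor>..\<lceil>2 * C\<rceil>} \<times> {\<lfloor>- 2 * C\<rfloor>..\<lceil>2 * C\<rceil>})"
    unfolding R mem_ring_of_integers_iff[OF sqf] by fast
  then show ?thesis by (rule finite_subset) auto
qed

end

section \<open>Pell's equation\<close>

text \<open>A rational \<open>sqrt m\<close> would be an algebraic integer, so an integer, and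
  \<open>m\<close> would be a perfect square.\<close>

lemma squarefree_sqrt_irrational:
  fixes m :: nat
  assumes "squarefree m" "m \<noteq> 1"
  shows "sqrt m \<notin> \<rat>"
proof
  assume "sqrt m \<in> \<rat>"
  moreover have "algebraic_int (sqrt m)" by auto
  ultimately have "sqrt m \<in> \<int>" using rational_algebraic_int_is_int by blast
  then obtain k :: int where k: "sqrt m = k" by (auto elim: Ints_cases)
  then have "real m = k\<^sup>2"
    by (metis of_nat_0_le_iff real_sqrt_pow2 of_int_power)
  then have "int m = k\<^sup>2" by (metis of_int_eq_iff of_int_of_nat_eq)
  then have "m = (nat \<bar>k\<bar>)\<^sup>2" by (metis nat_int nat_power_eq power2_abs abs_ge_zero)
  then have "nat \<bar>k\<bar> dvd 1"
    using assms(1) unfolding squarefree_def by (metis dvd_refl)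
  then show False using \<open>m = (nat \<bar>k\<bar>)\<^sup>2\<close> assms(2) by simp
qed

lemma irrational_quadratic_form_nonzero:
  fixes h k :: int
  assumes "sqrt m \<notin> \<rat>" "k \<noteq> 0"
  shows "h\<^sup>2 - int m * k\<^sup>2 \<noteq> 0"
proof
  assume "h\<^sup>2 - int m * k\<^sup>2 = 0"
  then have "real_of_int (h\<^sup>2) = real_of_int (int m * k\<^sup>2)" by simp
  then have "real m = (h / k)\<^sup>2" using assms(2) by (simp add: field_simps power_divide)
  then have "sqrt m = \<bar>h / k\<bar>" by simp
  then show False using assms(1) by auto
qed

text \<open>Factor the form as \<open>d * (d + 2 * k * sqrt m)\<close> with
  \<open>d = h - k * sqrt m\<close>. The quality of the approximation makes \<open>d\<close> smaller
  than \<open>1 / k\<close>, which compensates the factor \<open>k\<close>.\<close>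

lemma approx_set_norm_bound:
  fixes m :: nat
  assumes "(h, k) \<in> approx_set (sqrt m)"
  shows "\<bar>h\<^sup>2 - int m * k\<^sup>2\<bar> \<le> 2 * int m + 1"
proof -
  from assms have k: "k > 0" and lt: "\<bar>sqrt m - h / k\<bar> < 1 / k\<^sup>2"
    by (auto simp: approx_set_def)
  define d where "d = h - k * sqrt m"
  have "\<bar>d\<bar> = k * \<bar>sqrt m - h / k\<bar>"
  proof -
    have "d = - (k * (sqrt m - h / k))"
      using k by (simp add: d_def field_simps)
    then show ?thesis using k by (simp add: abs_mult)
  qed
  also have "\<dots> < k * (1 / k\<^sup>2)"
    by (rule mult_strict_left_mono[OF lt]) (use k in simp)
  also have "\<dots> = 1 / k" using k by (simp add: power2_eq_square)
  finally have d: "\<bar>d\<bar> < 1 / k" .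
  have "1 / real_of_int k \<le> 1" using k by simp
  then have d1: "\<bar>d\<bar> \<le> 1" using d by linarith
  have "real_of_int (h\<^sup>2 - int m * k\<^sup>2) = d * (d + 2 * k * sqrt m)"
    by (simp add: d_def algebra_simps power2_eq_square)
  then have "\<bar>real_of_int (h\<^sup>2 - int m * k\<^sup>2)\<bar> \<le> \<bar>d\<bar> * \<bar>d\<bar> + \<bar>d\<bar> * (2 * k * sqrt m)"
    using k abs_triangle_ineq[of "d * d" "d * (2 * k * sqrt m)"] by (simp add: abs_mult distrib_left)
  also have "\<dots> \<le> 1 + 1 / k * (2 * k * sqrt m)"
    using d d1 k by (intro add_mono mult_mono mult_le_one) auto
  also have "\<dots> = 1 + 2 * sqrt m" using k by simp
  also have "\<dots> \<le> 1 + 2 * real m"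
  proof -
    have "sqrt (real m) \<le> real m"
      by (cases "m = 0") (auto simp: real_sqrt_le_iff' intro!: real_le_lsqrt self_le_power)
    then show ?thesis by simp
  qed
  finally have "real_of_int \<bar>h\<^sup>2 - int m * k\<^sup>2\<bar> \<le> real_of_int (2 * int m + 1)" by simp
  then show ?thesis by (simp only: of_int_le_iff)
qed

text \<open>Two approximations of the same norm \<open>n\<close> that agree modulo \<open>n\<close> have a quotient
  in \<open>\<int>[\<surd>m]\<close>, of norm 1.\<close>

lemma pell_solution_exists:
  fixes m :: nat
  assumes irr: "sqrt m \<notin> \<rat>"
  shows "\<exists>x v :: int. v \<noteq> 0 \<and> x\<^sup>2 - int m * v\<^sup>2 = 1"
proof -
  define S where "S = approx_set (sqrt m)"
  define nm where "nm = (\<lambda>(h, k). h\<^sup>2 - int m * k\<^sup>2)"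
  \<comment> \<open>Pigeonhole: the norm is bounded and nonzero, so the norm together with both
    residues modulo it takes finitely many values on the infinite set \<open>S\<close>.\<close>
  define f where "f = (\<lambda>p. (nm p, fst p mod nm p, snd p mod nm p))"
  define M where "M = 2 * int m + 1"
  have inf: "infinite S"
    using irr rational_iff_finite_approx_set by (simp add: S_def)
  have pos: "snd p > 0" if "p \<in> S" for p
    using that by (auto simp: S_def approx_set_def)
  have bound: "\<bar>nm p\<bar> \<le> M" and nz: "nm p \<noteq> 0" if "p \<in> S" for p
    using that pos[OF that] approx_set_norm_bound irrational_quadratic_form_nonzero[OF irr]
    by (cases p; force simp: nm_def S_def M_def)+
  have "f ` S \<subseteq> {-M..M} \<times> {-M..M} \<times> {-M..M}"
  proof -
    have mod: "\<bar>a mod n\<bar> \<le> M" if "\<bar>n\<bar> \<le> M" "n \<noteq> 0" for a n :: int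
      using abs_mod_less[OF that(2), of a] that(1) by linarith
    have "f p \<in> {-M..M} \<times> {-M..M} \<times> {-M..M}" if "p \<in> S" for p
      using bound[OF that] mod[OF bound[OF that] nz[OF that], of "fst p"]
        mod[OF bound[OF that] nz[OF that], of "snd p"]
      by (simp add: f_def abs_le_iff)
    then show ?thesis by blast
  qed
  then have "finite (f ` S)" by (rule finite_subset) auto
  then have "\<not> inj_on f S" using inf finite_imageD by blast
  then obtain p p' where pp: "p \<in> S" "p' \<in> S" "p \<noteq> p'" "f p = f p'"
    by (auto simp: inj_on_def)
  obtain a b where p: "p = (a, b)" by (cases p)
  obtain c d where p': "p' = (c, d)" by (cases p')
  define n where "n = nm p"
  have n1: "a\<^sup>2 - int m * b\<^sup>2 = n" using p by (simp add: n_def nm_def)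
  have n2: "c\<^sup>2 - int m * d\<^sup>2 = n" using pp(4) p' by (simp add: f_def n_def nm_def)
  have n0: "n \<noteq> 0" using nz pp(1) by (simp add: n_def)
  have bd: "b > 0" "d > 0" using pos pp p p' by force+
  have "a mod n = c mod n" "b mod n = d mod n"
    using pp(4) by (auto simp: f_def n_def p p')
  then have "n dvd a - c" "n dvd b - d" by (simp_all add: mod_eq_dvd_iff)
  then obtain u w where uw: "a = c + n * u" "b = d + n * w"
    by (metis add.commute diff_add_cancel dvdE)
  \<comment> \<open>The coefficients of \<open>(a + b * sqrt m) / (c + d * sqrt m)\<close>. The
    congruences \<open>uw\<close> carry out the division by \<open>n\<close> inside the
    integers.\<close>
  define x v where "x = 1 + u * c - int m * w * d" and "v = w * c - u * d"
  have xn: "n * x = a * c - int m * b * d" and vn: "n * v = b * c - a * d"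
    unfolding x_def v_def uw using n2 by (simp_all add: algebra_simps power2_eq_square)
  have "n * n * (x\<^sup>2 - int m * v\<^sup>2) = (n * x)\<^sup>2 - int m * (n * v)\<^sup>2"
    by (simp add: power2_eq_square algebra_simps)
  also have "\<dots> = (a\<^sup>2 - int m * b\<^sup>2) * (c\<^sup>2 - int m * d\<^sup>2)"
    unfolding xn vn by (simp add: power2_eq_square algebra_simps)
  also have "\<dots> = n * n" using n1 n2 by simp
  finally have "x\<^sup>2 - int m * v\<^sup>2 = 1" using n0 by simp
  moreover have "v \<noteq> 0"
  proof
    \<comment> \<open>Then \<open>(a, b)\<close> and \<open>(c, d)\<close> are proportional; equal
      norms and positive second entries make them equal, contrary to the choice of two distinct
      approximations.\<close>
    assume "v = 0"
    then have eq: "b * c = a * d" using vn by simp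
    have "n * d\<^sup>2 = (a * d)\<^sup>2 - int m * b\<^sup>2 * d\<^sup>2"
      unfolding n1[symmetric] by (simp add: power2_eq_square algebra_simps)
    also have "\<dots> = n * b\<^sup>2"
      unfolding eq[symmetric] n2[symmetric] by (simp add: power2_eq_square algebra_simps)
    finally have "d = b" using n0 bd by (simp add: power2_eq_iff)
    then have "p = p'" using eq bd p p' by simp
    then show False using pp(3) by simp
  qed
  ultimately show ?thesis by blast
qed

section \<open>Quotients of the real line\<close>

text \<open>By the universal property each of the two maps factors through the other, and the two
  factorisations are mutually inverse.\<close>

lemma homeomorphic_space_quotient_maps:
  assumes f: "quotient_map X Y f" and g: "quotient_map X Z g"
    and eq: "\<And>x y. x \<in> topspace X \<Longrightarrow> y \<in> topspace X \<Longrightarrow> f x = f y \<longleftrightarrow> g x = g y"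
  shows "Y homeomorphic_space Z"
proof -
  obtain h where h: "continuous_map Y Z h" "\<And>x. x \<in> topspace X \<Longrightarrow> h (f x) = g x"
    using quotient_map_lift_exists[OF f quotient_imp_continuous_map[OF g]] eq by metis
  obtain k where k: "continuous_map Z Y k" "\<And>x. x \<in> topspace X \<Longrightarrow> k (g x) = f x"
    using quotient_map_lift_exists[OF g quotient_imp_continuous_map[OF f]] eq by metis
  have "homeomorphic_maps Y Z h k"
    unfolding homeomorphic_maps_def
    using h k quotient_imp_surjective_map[OF f] quotient_imp_surjective_map[OF g]
    by (metis (no_types, lifting) imageE)
  then show ?thesis
    unfolding homeomorphic_space_def by blast
qed

text \<open>If the preimage of \<open>U\<close> is closed, its part in \<open>K\<close> is compact
  and maps onto \<open>U\<close>, so \<open>U\<close> is closed. For a periodic map \<open>K\<close>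
  can be a fundamental domain.\<close>

lemma quotient_map_from_compact_cover:
  fixes f :: "'a :: t2_space \<Rightarrow> 'b :: t2_space"
  assumes cont: "continuous_on UNIV f" and K: "compact K" "f ` K = Y" "range f = Y"
  shows "quotient_map euclidean (top_of_set Y) f"
  unfolding quotient_map_closedin
proof (intro conjI allI impI)
  show "f ` topspace euclidean = topspace (top_of_set Y)"
    using K by simp
  fix U assume U: "U \<subseteq> topspace (top_of_set Y)"
  show "closedin euclidean {x \<in> topspace euclidean. f x \<in> U} \<longleftrightarrow> closedin (top_of_set Y) U"
  proof
    assume "closedin euclidean {x \<in> topspace euclidean. f x \<in> U}"
    then have "closed (f -` U)" by (simp add: vimage_def)
    then have "compact (f ` (K \<inter> f -` U))"
      using K(1) continuous_on_subset[OF cont] by (intro compact_continuous_image compact_Int_closed) auto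
    moreover have "f ` (K \<inter> f -` U) = U"
      using U K(2) by auto
    ultimately show "closedin (top_of_set Y) U"
      using U by (metis compact_imp_closed closed_subset topspace_euclidean_subtopology)
  next
    assume "closedin (top_of_set Y) U"
    then obtain T where T: "closed T" "U = Y \<inter> T" by (auto simp: closedin_closed)
    then have "{x. f x \<in> U} = f -` T" using K(3) by auto
    then show "closedin euclidean {x \<in> topspace euclidean. f x \<in> U}"
      using continuous_closed_vimage[OF T(1), of f] cont by (simp add: continuous_on_eq_continuous_at)
  qed
qed

lemma cis_eq_iff: "cis a = cis b \<longleftrightarrow> (\<exists>k::int. a = b + 2 * pi * k)"
proof -
  have "cis a = cis b \<longleftrightarrow> cis (a - b) = 1"
    by (auto simp: cis_divide[symmetric])
  also have "\<dots> \<longleftrightarrow> cos (a - b) = 1"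
    by (auto simp: complex_eq_iff cos_one_sin_zero)
  also have "\<dots> \<longleftrightarrow> (\<exists>k::int. a = b + 2 * pi * k)"
    unfolding cos_one_2pi_int by (auto simp: algebra_simps)
  finally show ?thesis .
qed

lemma cos_eq_cos_iff:
  fixes a b :: real
  shows "cos a = cos b \<longleftrightarrow> (\<exists>k::int. a = b + 2 * pi * k \<or> a = - b + 2 * pi * k)"
proof
  assume "cos a = cos b"
  then have "sin ((a + b) / 2) = 0 \<or> sin ((b - a) / 2) = 0"
    using cos_diff_cos[of a b] by auto
  then obtain k :: int where "(a + b) / 2 = k * pi \<or> (b - a) / 2 = k * pi"
    unfolding sin_zero_iff_int2 by blast
  then show "\<exists>k::int. a = b + 2 * pi * k \<or> a = - b + 2 * pi * k"
    by (elim disjE) (rule exI[of _ k] exI[of _ "- k"], simp add: field_simps)+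
next
  assume "\<exists>k::int. a = b + 2 * pi * k \<or> a = - b + 2 * pi * k"
  then show "cos a = cos b"
    by (auto simp: cos_add cos_diff)
qed

text \<open>The model quotient of the line by the translations by multiples of \<open>L\<close>,
  with fundamental domain \<open>{0..L}\<close>.\<close>

lemma quotient_map_circle:
  fixes L :: real
  assumes "L > 0"
  shows "quotient_map euclidean (top_of_set (sphere 0 1)) (\<lambda>s. cis (2 * pi * s / L))"
proof (rule quotient_map_from_compact_cover)
  show "continuous_on UNIV (\<lambda>s. cis (2 * pi * s / L))"
    using assms by (intro continuous_intros) auto
  show "compact {0..L}" by simp
  have "w \<in> (\<lambda>s. cis (2 * pi * s / L)) ` {0..L}" if "w \<in> sphere 0 1" for w
  proof -
    have "(Re w)\<^sup>2 + (Im w)\<^sup>2 = 1"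
      using that by (simp add: cmod_power2[symmetric])
    then obtain t where "0 \<le> t" "t < 2 * pi" "Re w = cos t" "Im w = sin t"
      by (rule sincos_total_2pi)
    then show ?thesis
      using assms by (intro image_eqI[of _ _ "L * t / (2 * pi)"]) (auto simp: complex_eq_iff field_simps)
  qed
  then show "(\<lambda>s. cis (2 * pi * s / L)) ` {0..L} = sphere 0 1"
    by auto
  then show "range (\<lambda>s. cis (2 * pi * s / L)) = sphere 0 1"
    by auto
qed

text \<open>The model quotient of the line by the infinite dihedral group generated by the
  translation by \<open>L\<close> and the reflection in \<open>c\<close>. The cosine folds the line
  onto the image of the fundamental domain \<open>{c..c + L / 2}\<close>.\<close>

lemma quotient_map_interval:
  fixes L c :: real
  assumes "L > 0"
  shows "quotient_map euclidean (top_of_set {0..1}) (\<lambda>s. (1 + cos (2 * pi * (s - c) / L)) / 2)"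
proof (rule quotient_map_from_compact_cover)
  show "continuous_on UNIV (\<lambda>s. (1 + cos (2 * pi * (s - c) / L)) / 2)"
    using assms by (intro continuous_intros) auto
  show "compact {c..c + L / 2}" by simp
  have "w \<in> (\<lambda>s. (1 + cos (2 * pi * (s - c) / L)) / 2) ` {c..c + L / 2}" if "w \<in> {0..1}" for w
  proof -
    define t where "t = arccos (2 * w - 1)"
    have t: "0 \<le> t" "t \<le> pi" "cos t = 2 * w - 1"
      using that by (auto simp: t_def arccos_lbound arccos_ubound)
    then show ?thesis
      using assms by (intro image_eqI[of _ _ "c + L * t / (2 * pi)"]) (auto simp: field_simps)
  qed
  moreover have "(1 + u) / 2 \<in> {0..1}" if "-1 \<le> u" "u \<le> 1" for u :: real
    using that by auto
  then have "(1 + cos x) / 2 \<in> {0..1}" for x :: real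
    using cos_le_one cos_ge_minus_one by blast
  ultimately show "(\<lambda>s. (1 + cos (2 * pi * (s - c) / L)) / 2) ` {c..c + L / 2} = {0..1}"
    "range (\<lambda>s. (1 + cos (2 * pi * (s - c) / L)) / 2) = {0..1}"
    by (blast+)
qed

text \<open>The generator \<open>L\<close> is the least positive element: the remainder of any
  element modulo \<open>L\<close> lies in \<open>T\<close> and is smaller than \<open>L\<close>, so
  it is zero.\<close>

lemma discrete_subgroup_real_cyclic:
  fixes T :: "real set"
  assumes add: "\<And>x y. x \<in> T \<Longrightarrow> y \<in> T \<Longrightarrow> x + y \<in> T" and minus: "\<And>x. x \<in> T \<Longrightarrow> - x \<in> T"
    and fin: "\<And>C. finite {x \<in> T. \<bar>x\<bar> \<le> C}" and nontriv: "t \<in> T" "t \<noteq> 0"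
  obtains L where "L > 0" "T = {of_int k * L | k :: int. True}"
proof -
  \<comment> \<open>Cutting off at the absolute value of \<open>t\<close> makes the set finite and
    nonempty, so that the minimum exists; larger elements exceed that minimum anyway.\<close>
  define F where "F = {x \<in> T. 0 < x \<and> x \<le> \<bar>t\<bar>}"
  have finF: "finite F" by (rule finite_subset[OF _ fin[of "\<bar>t\<bar>"]]) (auto simp: F_def)
  have "\<bar>t\<bar> \<in> F" using nontriv minus by (auto simp: F_def abs_if)
  define L where "L = Min F"
  have "L \<in> F" unfolding L_def using finF \<open>\<bar>t\<bar> \<in> F\<close> by (intro Min_in) auto
  then have L: "L \<in> T" "L > 0" "L \<le> \<bar>t\<bar>" by (auto simp: F_def)
  have least: "L \<le> x" if "x \<in> T" "x > 0" for x
    using that L(3) finF by (cases "x \<le> \<bar>t\<bar>") (auto simp: L_def F_def)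
  \<comment> \<open>The base case needs 0 in \<open>T\<close>, supplied as
    \<open>t + (- t)\<close>.\<close>
  have nat: "of_nat n * L \<in> T" for n
    using add[OF nontriv(1) minus[OF nontriv(1)]] L(1)
    by (induction n) (auto simp: algebra_simps intro: add)
  have int: "of_int k * L \<in> T" for k :: int
    using nat[of "nat k"] minus[OF nat[of "nat (- k)"]] by (cases "k \<ge> 0") auto
  have "\<exists>k::int. x = of_int k * L" if "x \<in> T" for x
  proof -
    define k where "k = \<lfloor>x / L\<rfloor>"
    have "x - of_int k * L \<in> T"
      using add[OF that minus[OF int[of k]]] by simp
    moreover have "of_int k * L \<le> x" "x < (of_int k + 1) * L"
      using L(2) floor_divide_lower[of L x] floor_divide_upper[of L x] by (auto simp: k_def)
    ultimately have "x - of_int k * L = 0"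
      using least[of "x - of_int k * L"] by (cases "x - of_int k * L > 0") (auto simp: algebra_simps)
    then show ?thesis by auto
  qed
  then have "T = {of_int k * L | k :: int. True}" using int by auto
  then show ?thesis using that L(2) by blast
qed

section \<open>Half-turns of hyperbolic space\<close>

definition mat22 :: "complex \<Rightarrow> complex \<Rightarrow> complex \<Rightarrow> complex \<Rightarrow> complex^2^2" where
  "mat22 a b c d = (\<chi> i j. if i = 1 then (if j = 1 then a else b) else (if j = 1 then c else d))"

lemma mat22_nth [simp]:
  "mat22 a b c d $ 1 $ 1 = a" "mat22 a b c d $ 1 $ 2 = b"
  "mat22 a b c d $ 2 $ 1 = c" "mat22 a b c d $ 2 $ 2 = d"
  by (simp_all add: mat22_def)

lemma mat2_eq_iff:
  fixes A B :: "complex^2^2"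
  shows "A = B \<longleftrightarrow> A $ 1 $ 1 = B $ 1 $ 1 \<and> A $ 1 $ 2 = B $ 1 $ 2 \<and> A $ 2 $ 1 = B $ 2 $ 1 \<and> A $ 2 $ 2 = B $ 2 $ 2"
  by (auto simp: vec_eq_iff forall_2)

lemma mat2_one_nth:
  "(mat 1 :: complex^2^2) $ 1 $ 1 = 1" "(mat 1 :: complex^2^2) $ 1 $ 2 = 0"
  "(mat 1 :: complex^2^2) $ 2 $ 1 = 0" "(mat 1 :: complex^2^2) $ 2 $ 2 = 1"
  by (simp_all add: mat_def)

abbreviation diag_i :: "complex^2^2" where
  "diag_i \<equiv> mat22 \<i> 0 0 (- \<i>)"

text \<open>If the trace were nonzero, the off-diagonal entries of the scalar matrix
  \<open>A ** A\<close> would force \<open>A\<close> to be diagonal, and its equal diagonal entries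
  would force \<open>A\<close> to be scalar, hence \<open>mat 1\<close> or
  \<open>- mat 1\<close>.\<close>

lemma mat2_order_two:
  fixes A :: "complex^2^2"
  assumes "det A = 1" "A ** A = mat 1 \<or> A ** A = - mat 1" "A \<noteq> mat 1" "A \<noteq> - mat 1"
  shows "A $ 2 $ 2 = - A $ 1 $ 1"
proof (rule ccontr)
  define a b c d where "a = A $ 1 $ 1" and "b = A $ 1 $ 2" and "c = A $ 2 $ 1" and "d = A $ 2 $ 2"
  note abcd = a_def b_def c_def d_def
  assume "A $ 2 $ 2 \<noteq> - A $ 1 $ 1"
  then have tr: "a + d \<noteq> 0" by (simp add: abcd add_eq_0_iff)
  have det: "a * d - b * c = 1" using assms(1) by (simp add: det_2 abcd)
  have sq: "b * (a + d) = 0" "c * (a + d) = 0" "a * a + b * c = d * d + b * c"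
  proof -
    have "(A ** A) $ 1 $ 2 = 0" "(A ** A) $ 2 $ 1 = 0" "(A ** A) $ 1 $ 1 = (A ** A) $ 2 $ 2"
      using assms(2) by (auto simp: mat2_one_nth)
    then show "b * (a + d) = 0" "c * (a + d) = 0" "a * a + b * c = d * d + b * c"
      by (simp_all add: mat2_mult_component abcd algebra_simps)
  qed
  then have "b = 0" "c = 0" using tr by auto
  moreover have "(a - d) * (a + d) = 0" using sq(3) by (simp add: algebra_simps)
  ultimately have "a = d" "a * a = 1" using tr det by auto
  then have "a = 1 \<or> a = -1" by (simp add: square_eq_1_iff)
  then show False
    using assms(3,4) \<open>a = d\<close> \<open>b = 0\<close> \<open>c = 0\<close> by (auto simp: mat2_eq_iff mat2_one_nth abcd)
qed

lemma mat2_diagonalise: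
  fixes A :: "complex^2^2"
  assumes tr: "A $ 2 $ 2 = - A $ 1 $ 1" and det: "det A = 1" and c: "A $ 2 $ 1 \<noteq> 0"
  obtains P Q where "det P = 1" "det Q = 1" "P ** Q = mat 1" "Q ** P = mat 1" "Q ** A ** P = diag_i"
proof -
  define a b c where "a = A $ 1 $ 1" and "b = A $ 1 $ 2" and "c = A $ 2 $ 1"
  have A: "A = mat22 a b c (- a)" using tr by (simp add: mat2_eq_iff a_def b_def c_def)
  have "b * c = a * (- a) - (a * (- a) - b * c)" by simp
  also have "a * (- a) - b * c = 1"
    using det by (simp add: A det_2)
  finally have "b * c = - (1 + a * a)" by simp
  moreover have c0: "c \<noteq> 0" using assms(3) by (simp add: c_def)
  ultimately have b: "b = - (1 + a * a) / c" by (simp add: nonzero_eq_divide_eq)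
  \<comment> \<open>The columns of \<open>P\<close> are eigenvectors of \<open>A\<close> for
    \<open>\<i>\<close> and \<open>- \<i>\<close>, the second scaled so that the determinant is 1;
    \<open>Q\<close> is the adjugate of \<open>P\<close>.\<close>
  define P where "P = mat22 (a + \<i>) ((a - \<i>) / (2 * \<i> * c)) c (1 / (2 * \<i>))"
  define Q where "Q = mat22 (1 / (2 * \<i>)) (- (a - \<i>) / (2 * \<i> * c)) (- c) (a + \<i>)"
  have "det P = 1" "det Q = 1"
    using c0 by (simp_all add: P_def Q_def det_2 field_simps)
  moreover have "P ** Q = mat 1" "Q ** P = mat 1"
    using c0 by (simp_all add: P_def Q_def mat2_eq_iff mat2_mult_component mat2_one_nth field_simps)
  moreover have "Q ** A ** P = diag_i"
    using c0 unfolding A b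
    by (simp add: P_def Q_def mat2_eq_iff mat2_mult_component field_simps)
  ultimately show ?thesis by (rule that)
qed

lemma commute_diag_i:
  assumes "D ** diag_i = diag_i ** D"
  shows "D $ 1 $ 2 = 0" "D $ 2 $ 1 = 0"
  using assms by (auto simp: mat2_eq_iff mat2_mult_component)

lemma anticommute_diag_i:
  assumes "D ** diag_i = - (diag_i ** D)"
  shows "D $ 1 $ 1 = 0" "D $ 2 $ 2 = 0"
  using assms by (auto simp: mat2_eq_iff mat2_mult_component)

lemma SL2_act_diagonal:
  assumes "det D = 1" "D $ 1 $ 2 = 0" "D $ 2 $ 1 = 0"
  shows "SL2_act D (0, r) = (0, (cmod (D $ 1 $ 1))\<^sup>2 * r)"
proof -
  have "cmod (D $ 1 $ 1) * cmod (D $ 2 $ 2) = 1"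
    using assms by (metis det_2 diff_zero mult_zero_left norm_mult norm_one)
  then have "cmod (D $ 2 $ 2) = inverse (cmod (D $ 1 $ 1))"
    by (metis inverse_unique)
  then have "r / (cmod (D $ 2 $ 2))\<^sup>2 = (cmod (D $ 1 $ 1))\<^sup>2 * r"
    by (simp add: power_inverse divide_inverse)
  then show ?thesis
    using assms by (simp add: SL2_act_def)
qed

lemma SL2_act_antidiagonal:
  assumes "det D = 1" "D $ 1 $ 1 = 0" "D $ 2 $ 2 = 0" "r > 0"
  shows "SL2_act D (0, r) = (0, (cmod (D $ 1 $ 2))\<^sup>2 / r)"
proof -
  have "cmod (D $ 1 $ 2) * cmod (D $ 2 $ 1) = 1"
  proof -
    have "- (D $ 1 $ 2 * D $ 2 $ 1) = 1" using assms by (simp add: det_2)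
    then show ?thesis by (metis norm_minus_cancel norm_mult norm_one)
  qed
  then have "cmod (D $ 2 $ 1) = inverse (cmod (D $ 1 $ 2))"
    by (metis inverse_unique)
  then have "r / ((cmod (D $ 2 $ 1))\<^sup>2 * r\<^sup>2) = (cmod (D $ 1 $ 2))\<^sup>2 / r"
    using assms(4) by (simp add: power_inverse divide_inverse power2_eq_square)
  then show ?thesis
    using assms by (simp add: SL2_act_def)
qed

text \<open>This matrix acts as the half-turn sending \<open>z\<close> to \<open>- z\<close> and
  keeping heights, so its axis is the vertical line over 0.\<close>

lemma SL2_act_diag_i_fixed: "SL2_act diag_i p = p \<longleftrightarrow> fst p = 0"
  by (cases p) (auto simp: SL2_act_def algebra_simps)

lemma continuous_on_SL2_act:
  assumes "det B = 1"
  shows "continuous_on hyp3 (SL2_act B)"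
proof -
  define N where "N p = (cmod (B $ 2 $ 1 * fst p + B $ 2 $ 2))\<^sup>2 + (cmod (B $ 2 $ 1))\<^sup>2 * (snd p)\<^sup>2"
    for p :: "complex \<times> real"
  define M where "M p = (B $ 1 $ 1 * fst p + B $ 1 $ 2) * cnj (B $ 2 $ 1 * fst p + B $ 2 $ 2)
      + B $ 1 $ 1 * cnj (B $ 2 $ 1) * of_real ((snd p)\<^sup>2)" for p :: "complex \<times> real"
  have ne: "N p \<noteq> 0" if "p \<in> hyp3" for p
    using act_N_pos[OF assms, of "snd p" "fst p"] that by (auto simp: hyp3_def N_def)
  have "continuous_on hyp3 N" "continuous_on hyp3 M"
    unfolding N_def M_def by (intro continuous_intros)+
  then have "continuous_on hyp3 (\<lambda>p. (M p / of_real (N p), snd p / N p))"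
    by (intro continuous_on_Pair continuous_on_divide continuous_on_of_real continuous_on_snd continuous_on_id)
      (simp_all add: ne)
  moreover have "SL2_act B = (\<lambda>p. (M p / of_real (N p), snd p / N p))"
    by (rule ext) (simp only: SL2_act_def Let_def N_def M_def)
  ultimately show ?thesis by simp
qed

section \<open>The rotation axis in the coordinates where \<open>A\<close> is diagonal\<close>

locale diagonalised_rotation =
  fixes A P Q :: "complex^2^2"
  assumes det: "det P = 1" "det Q = 1" "det A = 1"
    and PQ: "P ** Q = mat 1" "Q ** P = mat 1" and diag: "Q ** A ** P = diag_i"
begin

definition rot_axis :: "(complex \<times> real) set" where
  "rot_axis = {p \<in> hyp3. SL2_act A p = p}"

text \<open>The logarithm of the height is hyperbolic arc length on the vertical line; it turns
  scalings of the line into translations and inversions into reflections.\<close>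

definition axis_coord :: "complex \<times> real \<Rightarrow> real" where
  "axis_coord p = ln (snd (SL2_act Q p))"

definition axis_point :: "real \<Rightarrow> complex \<times> real" where
  "axis_point s = SL2_act P (0, exp s)"

lemma SL2_act_Q_P: "p \<in> hyp3 \<Longrightarrow> SL2_act Q (SL2_act P p) = p"
  using det PQ by (metis SL2_act_mult SL2_act_one)

lemma SL2_act_P_Q: "p \<in> hyp3 \<Longrightarrow> SL2_act P (SL2_act Q p) = p"
  using det PQ by (metis SL2_act_mult SL2_act_one)

lemma SL2_act_conj:
  assumes B: "det B = 1" and p: "p \<in> hyp3"
  shows "SL2_act Q (SL2_act B p) = SL2_act (Q ** B ** P) (SL2_act Q p)"
proof -
  have "SL2_act (Q ** B ** P) (SL2_act Q p) = SL2_act (Q ** B ** P ** Q) p"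
    using det p by (simp add: SL2_act_mult)
  also have "Q ** B ** P ** Q = Q ** B"
    by (metis PQ(1) matrix_mul_assoc matrix_mul_rid)
  finally show ?thesis using B p by (simp add: SL2_act_mult)
qed

lemma rot_axis_iff: "p \<in> rot_axis \<longleftrightarrow> p \<in> hyp3 \<and> fst (SL2_act Q p) = 0"
proof (cases "p \<in> hyp3")
  case True
  have "SL2_act A p = p \<longleftrightarrow> SL2_act Q (SL2_act A p) = SL2_act Q p"
    using True det by (metis SL2_act_P_Q SL2_act_in_hyp3)
  also have "\<dots> \<longleftrightarrow> fst (SL2_act Q p) = 0"
    using True det by (simp add: SL2_act_conj diag SL2_act_diag_i_fixed)
  finally show ?thesis using True by (simp add: rot_axis_def)
qed (simp add: rot_axis_def)

lemma axis_point_coord: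
  assumes "p \<in> rot_axis"
  shows "axis_point (axis_coord p) = p"
proof -
  have p: "p \<in> hyp3" "fst (SL2_act Q p) = 0" using assms by (auto simp: rot_axis_iff)
  then have "snd (SL2_act Q p) > 0" using SL2_act_in_hyp3[OF det(2) p(1)] by (simp add: hyp3_def)
  then have "SL2_act Q p = (0, exp (axis_coord p))"
    using p(2) by (simp add: axis_coord_def prod_eq_iff)
  then show ?thesis
    using SL2_act_P_Q[OF p(1)] by (simp add: axis_point_def)
qed

lemma zero_exp_hyp3: "(0, exp s) \<in> hyp3"
  by (simp add: hyp3_def)

lemma SL2_act_Q_axis_point: "SL2_act Q (axis_point s) = (0, exp s)"
  by (simp add: axis_point_def SL2_act_Q_P zero_exp_hyp3)

lemma axis_coord_point: "axis_coord (axis_point s) = s"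
  by (simp add: axis_coord_def SL2_act_Q_axis_point)

lemma axis_point_in_axis: "axis_point s \<in> rot_axis"
  by (simp add: rot_axis_iff SL2_act_Q_axis_point) (simp add: axis_point_def SL2_act_in_hyp3 det zero_exp_hyp3)

lemma SL2_act_axis_point:
  assumes B: "det B = 1" and D: "SL2_act (Q ** B ** P) (0, exp s) = (0, exp t)"
  shows "SL2_act B (axis_point s) = axis_point t"
proof -
  have hyp: "axis_point s \<in> hyp3" using axis_point_in_axis[of s] by (simp add: rot_axis_iff)
  have "SL2_act Q (SL2_act B (axis_point s)) = (0, exp t)"
    using D hyp B by (simp add: SL2_act_conj SL2_act_Q_axis_point)
  then show ?thesis
    using SL2_act_P_Q[OF SL2_act_in_hyp3[OF B hyp]] by (simp add: axis_point_def)
qed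

lemma conj_mult: "(Q ** B ** P) ** (Q ** C ** P) = Q ** (B ** C) ** P"
  by (metis PQ(1) matrix_mul_assoc matrix_mul_rid)

lemma det_conj: "det (Q ** B ** P) = det B"
  using det by (simp add: det_mul)

lemma conj_commute:
  assumes "B ** A = A ** B"
  shows "(Q ** B ** P) $ 1 $ 2 = 0" "(Q ** B ** P) $ 2 $ 1 = 0"
proof -
  have "(Q ** B ** P) ** diag_i = diag_i ** (Q ** B ** P)"
    using assms by (simp only: diag[symmetric] conj_mult)
  then show "(Q ** B ** P) $ 1 $ 2 = 0" "(Q ** B ** P) $ 2 $ 1 = 0"
    by (rule commute_diag_i)+
qed

lemma conj_anticommute:
  assumes "B ** A = - (A ** B)"
  shows "(Q ** B ** P) $ 1 $ 1 = 0" "(Q ** B ** P) $ 2 $ 2 = 0"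
proof -
  have "(Q ** B ** P) ** diag_i = - (diag_i ** (Q ** B ** P))"
    using assms by (simp only: diag[symmetric] conj_mult mat2_uminus_mult)
  then show "(Q ** B ** P) $ 1 $ 1 = 0" "(Q ** B ** P) $ 2 $ 2 = 0"
    by (rule anticommute_diag_i)+
qed

text \<open>For \<open>B\<close> commuting with \<open>A\<close>, the conjugate is
  \<open>diag(t, 1/t)\<close> and scales heights by the squared modulus of \<open>t\<close>; this is
  the resulting shift of \<open>axis_coord\<close>.\<close>

definition transl :: "complex^2^2 \<Rightarrow> real" where
  "transl B = 2 * ln (cmod ((Q ** B ** P) $ 1 $ 1))"

text \<open>For \<open>B\<close> anticommuting with \<open>A\<close>, the conjugate is antidiagonal
  and inverts heights. The induced reflection has its centre at half of this constant.\<close>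

definition refl_const :: "complex^2^2 \<Rightarrow> real" where
  "refl_const B = 2 * ln (cmod ((Q ** B ** P) $ 1 $ 2))"

lemma conj_commute_nonzero:
  assumes "det B = 1" "B ** A = A ** B"
  shows "(Q ** B ** P) $ 1 $ 1 * (Q ** B ** P) $ 2 $ 2 = 1" "(Q ** B ** P) $ 1 $ 1 \<noteq> 0"
proof -
  show "(Q ** B ** P) $ 1 $ 1 * (Q ** B ** P) $ 2 $ 2 = 1"
    using assms det_conj[of B] conj_commute[OF assms(2)] by (simp add: det_2)
  then show "(Q ** B ** P) $ 1 $ 1 \<noteq> 0" by auto
qed

lemma conj_anticommute_nonzero:
  assumes "det B = 1" "B ** A = - (A ** B)"
  shows "(Q ** B ** P) $ 1 $ 2 \<noteq> 0"
  using assms det_conj[of B] conj_anticommute[OF assms(2)] by (auto simp: det_2)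

lemma SL2_act_commute:
  assumes B: "det B = 1" "B ** A = A ** B"
  shows "SL2_act B (axis_point s) = axis_point (s + transl B)"
proof (rule SL2_act_axis_point[OF B(1)])
  show "SL2_act (Q ** B ** P) (0, exp s) = (0, exp (s + transl B))"
    using SL2_act_diagonal[OF _ conj_commute[OF B(2)]] det_conj[of B] B conj_commute_nonzero[OF B]
    by (simp add: exp_add transl_def exp_double)
qed

lemma SL2_act_anticommute:
  assumes B: "det B = 1" "B ** A = - (A ** B)"
  shows "SL2_act B (axis_point s) = axis_point (refl_const B - s)"
proof (rule SL2_act_axis_point[OF B(1)])
  show "SL2_act (Q ** B ** P) (0, exp s) = (0, exp (refl_const B - s))"
    using SL2_act_antidiagonal[OF _ conj_anticommute[OF B(2)]] det_conj[of B] B conj_anticommute_nonzero[OF B]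
    by (simp add: exp_diff refl_const_def exp_double)
qed

lemma transl_mult:
  assumes "det B = 1" "B ** A = A ** B" "det C = 1" "C ** A = A ** C"
  shows "transl (B ** C) = transl B + transl C"
proof -
  have "(Q ** (B ** C) ** P) $ 1 $ 1 = (Q ** B ** P) $ 1 $ 1 * (Q ** C ** P) $ 1 $ 1"
    unfolding conj_mult[symmetric] mat2_mult_component[of "Q ** B ** P" "Q ** C ** P"]
    using conj_commute[OF assms(2)] by simp
  then show ?thesis
    using conj_commute_nonzero(2)[OF assms(1,2)] conj_commute_nonzero(2)[OF assms(3,4)]
    by (simp add: transl_def norm_mult ln_mult)
qed

lemma refl_const_mult:
  assumes "det B = 1" "B ** A = - (A ** B)" "det C = 1" "C ** A = A ** C"
  shows "refl_const (C ** B) = transl C + refl_const B"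
proof -
  have "(Q ** (C ** B) ** P) $ 1 $ 2 = (Q ** C ** P) $ 1 $ 1 * (Q ** B ** P) $ 1 $ 2"
    unfolding conj_mult[symmetric] mat2_mult_component[of "Q ** C ** P" "Q ** B ** P"]
    using conj_commute[OF assms(4)] by simp
  then show ?thesis
    using conj_anticommute_nonzero[OF assms(1,2)] conj_commute_nonzero(2)[OF assms(3,4)]
    by (simp add: transl_def refl_const_def norm_mult ln_mult)
qed

text \<open>Invariance of the trace under conjugation ties the multiplier, a complex number, to the
  entries of \<open>B\<close>, which later lie in a discrete ring.\<close>

lemma trace_commute:
  assumes "det B = 1" "B ** A = A ** B"
  shows "B $ 1 $ 1 + B $ 2 $ 2 = (Q ** B ** P) $ 1 $ 1 + inverse ((Q ** B ** P) $ 1 $ 1)"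
proof -
  have "trace (Q ** B ** P) = trace B"
    by (metis PQ(1) matrix_mul_assoc matrix_mul_rid trace_mul_sym)
  then have "B $ 1 $ 1 + B $ 2 $ 2 = (Q ** B ** P) $ 1 $ 1 + (Q ** B ** P) $ 2 $ 2"
    by (simp add: trace_def sum_2)
  moreover have "(Q ** B ** P) $ 2 $ 2 = inverse ((Q ** B ** P) $ 1 $ 1)"
    using conj_commute_nonzero(1)[OF assms] by (metis inverse_unique)
  ultimately show ?thesis by simp
qed

lemma homeomorphic_map_axis_coord: "homeomorphic_map (top_of_set rot_axis) euclidean axis_coord"
proof -
  have sub: "rot_axis \<subseteq> hyp3" by (auto simp: rot_axis_def)
  have "continuous_on rot_axis (SL2_act Q)"
    using continuous_on_subset[OF continuous_on_SL2_act[OF det(2)] sub] .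
  moreover have "snd (SL2_act Q p) > 0" if "p \<in> rot_axis" for p
    using SL2_act_in_hyp3[OF det(2), of p] that unfolding rot_axis_iff by (simp add: hyp3_def)
  ultimately have c1: "continuous_on rot_axis axis_coord"
    unfolding axis_coord_def by (intro continuous_intros) force+
  have "continuous_on UNIV (SL2_act P \<circ> (\<lambda>s. (0, exp s)))"
    using zero_exp_hyp3
    by (intro continuous_on_compose continuous_intros continuous_on_subset[OF continuous_on_SL2_act[OF det(1)]]) auto
  then have c2: "continuous_on UNIV axis_point"
    by (simp add: axis_point_def[abs_def] o_def)
  have "homeomorphic_maps (top_of_set rot_axis) euclidean axis_coord axis_point"
    unfolding homeomorphic_maps_def
    using c1 c2 axis_coord_point axis_point_coord axis_point_in_axis
    by (auto simp: continuous_map_in_subtopology)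
  then show ?thesis
    by (rule homeomorphic_maps_imp_map)
qed

end

section \<open>Involutions and Klein four-groups\<close>

lemma (in group) ord_eq_two_iff:
  assumes "x \<in> carrier G"
  shows "ord x = 2 \<longleftrightarrow> x \<noteq> \<one> \<and> x \<otimes> x = \<one>"
proof
  assume "ord x = 2"
  then have "x [^] (2::nat) = \<one>" "x \<noteq> \<one>"
    using assms pow_ord_eq_1[of x] ord_eq_1[of x] by auto
  then show "x \<noteq> \<one> \<and> x \<otimes> x = \<one>"
    using assms by (simp add: numeral_2_eq_2)
next
  assume x: "x \<noteq> \<one> \<and> x \<otimes> x = \<one>"
  then have "x [^] (2::nat) = \<one>" using assms by (simp add: numeral_2_eq_2)
  then have "ord x dvd 2" using assms pow_eq_id by blast
  moreover have "ord x \<noteq> 1" using x assms ord_eq_1 by blast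
  ultimately show "ord x = 2"
    by (metis dvd_imp_le le_Suc_eq numeral_2_eq_2 One_nat_def dvd_0_left_iff le_0_eq zero_less_numeral zero_neq_numeral)
qed

text \<open>Forwards, a set of four elements has a member outside the identity and \<open>g\<close>,
  and an injective homomorphism pulls back commutativity and exponent 2. Backwards, the identity,
  \<open>g\<close>, \<open>x\<close> and their product \<open>g x\<close> form the subgroup.\<close>

lemma (in group) in_klein_four_subgroup_iff:
  assumes g: "g \<in> carrier G" "g \<noteq> \<one>" "g \<otimes> g = \<one>"
  shows "(\<exists>H. subgroup H G \<and> generate G {g} \<subseteq> H \<and>
             G\<lparr>carrier := H\<rparr> \<cong> integer_mod_group 2 \<times>\<times> integer_mod_group 2) \<longleftrightarrow>
         (\<exists>x\<in>carrier G. x \<noteq> \<one> \<and> x \<noteq> g \<and> x \<otimes> x = \<one> \<and> x \<otimes> g = g \<otimes> x)"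
    (is "?klein \<longleftrightarrow> ?inv")
proof
  let ?V = "integer_mod_group 2 \<times>\<times> integer_mod_group 2"
  have cV: "carrier ?V = {(0,0),(0,1),(1,0),(1,1)}"
    by (auto simp: carrier_integer_mod_group DirProd_def)
  assume ?klein
  then obtain H where H: "subgroup H G" "generate G {g} \<subseteq> H" and "G\<lparr>carrier := H\<rparr> \<cong> ?V"
    by blast
  then obtain f where f: "f \<in> iso (G\<lparr>carrier := H\<rparr>) ?V"
    unfolding is_iso_def by blast
  then have bij: "bij_betw f H (carrier ?V)" and hom: "\<And>x y. x \<in> H \<Longrightarrow> y \<in> H \<Longrightarrow> f (x \<otimes> y) = f x \<otimes>\<^bsub>?V\<^esub> f y"
    by (auto simp: iso_def hom_def)
  have gH: "g \<in> H" using H(2) generate.incl[of g "{g}"] by auto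
  have one: "\<one> \<in> H" using H(1) by (rule subgroup.one_closed)
  have card: "card H = 4" using bij_betw_same_card[OF bij] unfolding cV by simp
  have "\<not> H \<subseteq> {\<one>, g}"
    using card card_mono[of "{\<one>, g}" H] card_insert_le_m1[of 2 "{g}" \<one>] by auto
  then obtain x where x: "x \<in> H" "x \<noteq> \<one>" "x \<noteq> g" by blast
  have closed: "y \<otimes> z \<in> H" if "y \<in> H" "z \<in> H" for y z
    using H(1) that by (rule subgroup.m_closed)
  have eq: "y = z" if "f y = f z" "y \<in> H" "z \<in> H" for y z
    using bij that by (auto simp: bij_betw_def inj_on_def)
  have fV: "f y \<in> carrier ?V" if "y \<in> H" for y
    using bij that by (auto simp: bij_betw_def)
  have "x \<otimes> g = g \<otimes> x"
    using fV[OF x(1)] fV[OF gH] x(1) gH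
    by (intro eq closed) (auto simp: hom cV add.commute)
  moreover have "x \<otimes> x = \<one>"
  proof (rule eq)
    show "f (x \<otimes> x) = f \<one>"
      using fV[OF x(1)] fV[OF one] hom[OF x(1) x(1)] hom[OF one one] by (auto simp: cV)
  qed (use x one closed in auto)
  moreover have "x \<in> carrier G" by (rule subgroup.mem_carrier[OF H(1) x(1)])
  ultimately show ?inv using x(2,3) by metis
next
  let ?V = "integer_mod_group 2 \<times>\<times> integer_mod_group 2"
  have cV: "carrier ?V = {(0,0),(0,1),(1,0),(1,1)}"
    by (auto simp: carrier_integer_mod_group DirProd_def)
  assume ?inv
  then obtain x where x: "x \<in> carrier G" "x \<noteq> \<one>" "x \<noteq> g" "x \<otimes> x = \<one>" "x \<otimes> g = g \<otimes> x"
    by blast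
  define H where "H = {\<one>, g, x, g \<otimes> x}"
  have cancel: "g \<otimes> (g \<otimes> y) = y" "x \<otimes> (x \<otimes> y) = y" "x \<otimes> (g \<otimes> y) = g \<otimes> (x \<otimes> y)"
    if "y \<in> carrier G" for y
    using g x that by (simp_all flip: m_assoc)
  note rules = g x cancel m_assoc
  have inv: "inv g = g" "inv x = x" "inv (g \<otimes> x) = g \<otimes> x"
    using g x by (auto intro!: inv_equality simp: m_assoc cancel)
  have sub: "subgroup H G"
    by (rule subgroupI) (use rules inv in \<open>auto simp: H_def\<close>)
  have ne: "g \<otimes> x \<noteq> \<one>" "g \<otimes> x \<noteq> g" "g \<otimes> x \<noteq> x"
  proof -
    show "g \<otimes> x \<noteq> \<one>"
      using cancel(1)[OF x(1)] g x by (metis r_one)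
    show "g \<otimes> x \<noteq> g" using g x by simp
    show "g \<otimes> x \<noteq> x" using g x by simp
  qed
  have "generate G {g} \<subseteq> H"
    using sub by (intro generate_subgroup_incl) (auto simp: H_def)
  moreover have "G\<lparr>carrier := H\<rparr> \<cong> ?V"
  proof -
    define f where "f y = (if y = \<one> then (0, 0) else if y = g then (0, 1) else if y = x then (1, 0) else (1, 1) :: int \<times> int)" for y
    have f: "f \<one> = (0, 0)" "f g = (0, 1)" "f x = (1, 0)" "f (g \<otimes> x) = (1, 1)"
      using g x ne by (auto simp: f_def)
    have "f (y \<otimes> z) = f y \<otimes>\<^bsub>?V\<^esub> f z" if "y \<in> H" "z \<in> H" for y z
    proof -
      have "y = \<one> \<or> y = g \<or> y = x \<or> y = g \<otimes> x" "z = \<one> \<or> z = g \<or> z = x \<or> z = g \<otimes> x"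
        using that by (auto simp: H_def)
      then show ?thesis
        by (elim disjE) (simp_all add: f g(1,3) x(1,4,5) cancel m_assoc)
    qed
    moreover have "f y \<in> carrier ?V" for y
      unfolding cV f_def by simp
    ultimately have "f \<in> hom (G\<lparr>carrier := H\<rparr>) ?V"
      by (simp add: hom_def)
    moreover have "bij_betw f H (carrier ?V)"
      unfolding bij_betw_def cV inj_on_def using f by (auto simp: H_def)
    ultimately show ?thesis
      unfolding is_iso_def iso_def by auto
  qed
  ultimately show ?klein using sub by blast
qed

section \<open>Computing with matrices up to sign\<close>

lemma PSL2_mult: "{A, - A} \<otimes>\<^bsub>PSL2 R\<^esub> {B, - B} = {A ** B, - (A ** B)}"
  by (auto simp: PSL2_def FactGroup_def set_mult_def SL2_def mat2_uminus_mult)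

lemma PSL2_one: "\<one>\<^bsub>PSL2 R\<^esub> = {mat 1, - mat 1}"
  by (simp add: PSL2_def FactGroup_def)

lemma pm_eq_iff: "{A, - A} = {B, - B} \<longleftrightarrow> A = B \<or> A = - B" for A B :: "complex^2^2"
  by (auto simp: doubleton_eq_iff)

text \<open>Equality of cosets is equality up to sign, which lets anticommuting matrices enter the
  centralizer beside the commuting ones.\<close>

lemma centralizer_PSL2:
  assumes "A \<in> carrier (SL2 R)"
  shows "centralizer (PSL2 R) {A, - A} =
    {{B, - B} | B. B \<in> carrier (SL2 R) \<and> (B ** A = A ** B \<or> B ** A = - (A ** B))}"
  unfolding centralizer_def carrier_PSL2 using PSL2_mult pm_eq_iff by force

section \<open>Centralizers in Bianchi groups\<close>

text \<open>The condition \<open>m_ne_1\<close> makes \<open>sqrt m\<close> irrational and thereby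
  Pell's equation solvable; \<open>A_trace\<close> expresses that \<open>A\<close> lifts an
  involution.\<close>

locale bianchi_rotation = diagonalised_rotation +
  fixes m :: nat and R :: "complex set"
  assumes sqf: "squarefree m" and m_ne_1: "m \<noteq> 1"
    and R_def: "R = ring_of_integers (imag_quadratic_field m)"
    and A_in: "A \<in> carrier (SL2 R)" and A_trace: "A $ 2 $ 2 = - A $ 1 $ 1"
begin

lemma ring_R:
  shows "1 \<in> R" "x \<in> R \<Longrightarrow> y \<in> R \<Longrightarrow> x + y \<in> R"
    "x \<in> R \<Longrightarrow> y \<in> R \<Longrightarrow> x * y \<in> R" "x \<in> R \<Longrightarrow> - x \<in> R"
  using ring_of_integers_of_int[OF sqf R_def, of 1] ring_of_integers_add[OF sqf R_def]
    ring_of_integers_mult[OF sqf R_def] ring_of_integers_uminus[OF sqf R_def] by simp_all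

sublocale G: group "SL2 R"
  by (rule group_SL2) (use ring_R in auto)

lemma SL2_mult: "B \<in> carrier (SL2 R) \<Longrightarrow> C \<in> carrier (SL2 R) \<Longrightarrow> B ** C \<in> carrier (SL2 R)"
  using G.m_closed by (simp add: SL2_def)

lemma SL2_det: "B \<in> carrier (SL2 R) \<Longrightarrow> det B = 1"
  by (simp add: SL2_def)

lemma SL2_inverse:
  assumes "B \<in> carrier (SL2 R)"
  obtains C where "C \<in> carrier (SL2 R)" "C ** B = mat 1" "B ** C = mat 1"
  using G.inv_closed[OF assms] G.l_inv[OF assms] G.r_inv[OF assms] that by (simp add: SL2_def)

section \<open>The translation lattice and the reflections\<close>

definition commuting :: "(complex^2^2) set" where
  "commuting = {B \<in> carrier (SL2 R). B ** A = A ** B}"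

definition anticommuting :: "(complex^2^2) set" where
  "anticommuting = {B \<in> carrier (SL2 R). B ** A = - (A ** B)}"

lemma commuting_mult:
  assumes "B \<in> commuting" "C \<in> commuting"
  shows "B ** C \<in> commuting"
  using assms SL2_mult by (simp add: commuting_def) (metis matrix_mul_assoc)

lemma commuting_inverse:
  assumes "B \<in> commuting"
  obtains C where "C \<in> commuting" "C ** B = mat 1"
proof -
  obtain C where C: "C \<in> carrier (SL2 R)" "C ** B = mat 1" "B ** C = mat 1"
    using assms SL2_inverse by (auto simp: commuting_def)
  have "C ** A = C ** (A ** B) ** C"
    by (metis C(3) matrix_mul_assoc matrix_mul_rid)
  also have "\<dots> = C ** (B ** A) ** C"
    using assms by (simp add: commuting_def)
  also have "\<dots> = A ** C"
    by (metis C(2) matrix_mul_assoc matrix_mul_lid)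
  finally show ?thesis using that C by (simp add: commuting_def)
qed

lemma transl_one: "transl (mat 1) = 0"
  by (simp add: transl_def PQ mat2_one_nth)

text \<open>\<open>B\<close> is \<open>x\<close> times the identity plus \<open>y\<close> times
  \<open>A\<close>. As \<open>A\<close> squares to minus the identity, it acts like
  \<open>\<i>\<close>: the determinant is the norm form, and \<open>x + y * \<i>\<close> is an
  eigenvalue.\<close>

lemma mat_scale_plus:
  fixes x y :: complex
  defines "B \<equiv> mat22 (x + y * A $ 1 $ 1) (y * A $ 1 $ 2) (y * A $ 2 $ 1) (x + y * A $ 2 $ 2)"
  shows "B ** A = A ** B" "det B = x\<^sup>2 + y\<^sup>2" "(Q ** B ** P) $ 1 $ 1 = x + y * \<i>"
proof -
  show "B ** A = A ** B"
    by (simp add: B_def mat2_eq_iff mat2_mult_component algebra_simps)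
  have "A $ 1 $ 2 * A $ 2 $ 1 = A $ 1 $ 1 * A $ 2 $ 2 - det A"
    by (simp add: det_2)
  then have *: "A $ 1 $ 2 * A $ 2 $ 1 = - 1 - A $ 1 $ 1 * A $ 1 $ 1"
    by (simp add: det A_trace)
  have "det B = x\<^sup>2 - y\<^sup>2 * (A $ 1 $ 1 * A $ 1 $ 1) - y\<^sup>2 * (A $ 1 $ 2 * A $ 2 $ 1)"
    by (simp add: B_def det_2 A_trace algebra_simps power2_eq_square)
  then show "det B = x\<^sup>2 + y\<^sup>2"
    unfolding * by (simp add: algebra_simps)
  have "(Q ** B ** P) $ 1 $ 1 = x * (Q ** P) $ 1 $ 1 + y * (Q ** A ** P) $ 1 $ 1"
    by (simp add: B_def mat2_mult_component algebra_simps)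
  then show "(Q ** B ** P) $ 1 $ 1 = x + y * \<i>"
    by (simp add: PQ diag mat2_one_nth)
qed

text \<open>A solution of Pell's equation \<open>x\<^sup>2 - m v\<^sup>2 = 1\<close> gives the hyperbolic element
  \<open>x + v \<surd>(-m) A\<close> with multiplier \<open>x - v \<surd>m\<close>.\<close>

lemma nontrivial_translation: "\<exists>B\<in>commuting. transl B \<noteq> 0"
proof -
  obtain x v :: int where v: "v \<noteq> 0" and pell: "x\<^sup>2 - int m * v\<^sup>2 = 1"
    using pell_solution_exists squarefree_sqrt_irrational[OF sqf m_ne_1] by blast
  define y where "y = of_int v * (\<i> * of_real (sqrt m))"
  define B where "B = mat22 (of_int x + y * A $ 1 $ 1) (y * A $ 1 $ 2) (y * A $ 2 $ 1) (of_int x + y * A $ 2 $ 2)"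
  note B = mat_scale_plus[of "of_int x" y, folded B_def]
  have y2: "y\<^sup>2 = - of_int (int m * v\<^sup>2)"
  proof -
    have "(complex_of_real (sqrt m))\<^sup>2 = of_nat m"
      by (metis of_nat_0_le_iff of_real_of_nat_eq of_real_power real_sqrt_pow2)
    then show ?thesis by (simp add: y_def power_mult_distrib)
  qed
  have det: "det B = 1"
  proof -
    have "det B = of_int (x\<^sup>2 - int m * v\<^sup>2)" unfolding B(2) y2 by simp
    then show ?thesis unfolding pell by simp
  qed
  have "y \<in> R" "of_int x \<in> R"
    using ring_of_integers_sqrt[OF sqf R_def] ring_of_integers_of_int[OF sqf R_def] by (simp_all add: y_def)
  then have "B \<in> carrier (SL2 R)"
    using A_in det ring_R by (simp add: SL2_def B_def forall_2)
  then have "B \<in> commuting"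
    using B(1) by (simp add: commuting_def)
  moreover have "transl B \<noteq> 0"
  proof
    define t where "t = real_of_int x - of_int v * sqrt m"
    have "(Q ** B ** P) $ 1 $ 1 = of_real t"
      unfolding B(3) by (simp add: y_def t_def algebra_simps)
    moreover assume "transl B = 0"
    moreover have unit: "t * (of_int x + of_int v * sqrt m) = 1"
    proof -
      have "t * (of_int x + of_int v * sqrt m) = of_int (x\<^sup>2 - int m * v\<^sup>2)"
        by (simp add: t_def algebra_simps power2_eq_square)
      then show ?thesis unfolding pell by simp
    qed
    moreover have "t \<noteq> 0" using unit by auto
    ultimately have "\<bar>t\<bar> = 1"
      by (simp add: transl_def)
    \<comment> \<open>A real number of absolute value 1 is its own inverse, and the inverse of
      \<open>t\<close> is its conjugate; so the irrational part vanishes.\<close>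
    then have "t = of_int x + of_int v * sqrt m"
      using unit by (auto simp: abs_if split: if_splits)
    then have "of_int v * sqrt m = 0" by (simp add: t_def)
    then have "m = 0" using v by simp
    then show False using sqf by simp
  qed
  ultimately show ?thesis by blast
qed

text \<open>The multiplier \<open>t\<close> satisfies \<open>t + 1/t = trace B \<in> R\<close>, so discreteness of \<open>R\<close>
  makes the translation lengths discrete.\<close>

lemma finite_translations_bounded: "finite {x \<in> transl ` commuting. \<bar>x\<bar> \<le> C}"
proof -
  define Z where "Z = {z \<in> R. cmod z \<le> 2 * exp (C / 2)}"
  \<comment> \<open>The equation \<open>t + 1/t = z\<close> reads
    \<open>t^2 - z * t + 1 = 0\<close>, so each trace \<open>z\<close> allows only finitely many
    multipliers.\<close>
  define roots where "roots z = {t. poly [:1, - z, 1:] t = 0}" for z :: complex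
  have "finite (\<Union>z\<in>Z. roots z)"
    unfolding Z_def roots_def
    using finite_ring_of_integers_bounded[OF sqf R_def] by (intro finite_UN_I poly_roots_finite) auto
  moreover have "{x \<in> transl ` commuting. \<bar>x\<bar> \<le> C} \<subseteq> (\<lambda>t. 2 * ln (cmod t)) ` (\<Union>z\<in>Z. roots z)"
  proof
    fix x assume "x \<in> {x \<in> transl ` commuting. \<bar>x\<bar> \<le> C}"
    then obtain B where B: "B \<in> commuting" "x = transl B" "\<bar>x\<bar> \<le> C" by blast
    have det: "det B = 1" and com: "B ** A = A ** B" and entries: "B $ 1 $ 1 \<in> R" "B $ 2 $ 2 \<in> R"
      using B(1) by (auto simp: commuting_def SL2_def)
    define t where "t = (Q ** B ** P) $ 1 $ 1"
    define z where "z = B $ 1 $ 1 + B $ 2 $ 2"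
    have t0: "t \<noteq> 0" using conj_commute_nonzero(2)[OF det com] by (simp add: t_def)
    have zt: "z = t + inverse t" using trace_commute[OF det com] by (simp add: z_def t_def)
    have x: "x = 2 * ln (cmod t)" using B(2) by (simp add: transl_def t_def)
    have "cmod t = exp (x / 2)" using t0 by (simp add: x)
    then have "cmod t \<le> exp (C / 2)" "cmod (inverse t) \<le> exp (C / 2)"
      using B(3) by (simp_all add: norm_inverse exp_minus[symmetric])
    then have "cmod z \<le> 2 * exp (C / 2)"
      unfolding zt using norm_triangle_ineq[of t "inverse t"] by linarith
    then have "z \<in> Z" using entries ring_R by (simp add: Z_def z_def)
    moreover have "t \<in> roots z"
      using t0 by (simp add: roots_def zt field_simps)
    ultimately show "x \<in> (\<lambda>t. 2 * ln (cmod t)) ` (\<Union>z\<in>Z. roots z)"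
      using x by blast
  qed
  ultimately show ?thesis by (rule finite_surj)
qed

lemma translation_lattice:
  obtains L where "L > 0" "transl ` commuting = {of_int k * L | k :: int. True}"
proof -
  have add: "transl (B ** C) = transl B + transl C" if "B \<in> commuting" "C \<in> commuting" for B C
    using that by (intro transl_mult) (auto simp: commuting_def SL2_det)
  obtain B where "B \<in> commuting" "transl B \<noteq> 0"
    using nontrivial_translation by blast
  then have t: "transl B \<in> transl ` commuting" "transl B \<noteq> 0" by auto
  have 1: "x + y \<in> transl ` commuting" if "x \<in> transl ` commuting" "y \<in> transl ` commuting" for x y
    using that by (auto simp: add[symmetric] intro!: imageI commuting_mult)
  have 2: "- x \<in> transl ` commuting" if "x \<in> transl ` commuting" for x
  proof -
    obtain B where B: "B \<in> commuting" "x = transl B" using \<open>x \<in> transl ` commuting\<close> by auto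
    obtain C where C: "C \<in> commuting" "C ** B = mat 1" using commuting_inverse[OF B(1)] .
    have "transl C = - x" using add[OF C(1) B(1)] B(2) by (simp add: C(2) transl_one)
    then show ?thesis using C(1) by force
  qed
  show ?thesis
    using discrete_subgroup_real_cyclic[OF 1 2 finite_translations_bounded t] that by blast
qed

text \<open>The anticommuting matrices form the coset \<open>C ** B\<close> of the commuting ones,
  so the reflection constants form a translate of the translation lattice.\<close>

lemma refl_consts:
  assumes B: "B \<in> anticommuting"
  shows "refl_const ` anticommuting = (\<lambda>x. x + refl_const B) ` transl ` commuting"
proof (intro equalityI subsetI)
  fix x assume "x \<in> (\<lambda>x. x + refl_const B) ` transl ` commuting"
  then obtain C where C: "C \<in> commuting" "x = transl C + refl_const B" by auto
  have "(C ** B) ** A = - (A ** (C ** B))"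
    using B C(1) by (simp add: anticommuting_def commuting_def matrix_mul_assoc[symmetric] mat2_uminus_mult)
      (simp add: matrix_mul_assoc)
  then have "C ** B \<in> anticommuting"
    using B C(1) SL2_mult by (simp add: anticommuting_def commuting_def)
  moreover have "refl_const (C ** B) = x"
    unfolding C(2) using B C(1) by (intro refl_const_mult) (auto simp: anticommuting_def commuting_def SL2_det)
  ultimately show "x \<in> refl_const ` anticommuting" by force
next
  fix x assume "x \<in> refl_const ` anticommuting"
  then obtain D where D: "D \<in> anticommuting" "x = refl_const D" by blast
  obtain B' where B': "B' \<in> carrier (SL2 R)" "B' ** B = mat 1" "B ** B' = mat 1"
    using B SL2_inverse by (auto simp: anticommuting_def)
  \<comment> \<open>The inverse of \<open>B\<close> anticommutes with \<open>A\<close> as well, so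
    the two signs cancel in \<open>D ** B'\<close>.\<close>
  have "B' ** A = B' ** (A ** B) ** B'"
    by (metis B'(3) matrix_mul_assoc matrix_mul_rid)
  also have "A ** B = - (B ** A)"
    using B by (simp add: anticommuting_def)
  also have "B' ** - (B ** A) ** B' = - (A ** B')"
    by (metis B'(2) mat2_uminus_mult matrix_mul_assoc matrix_mul_lid)
  finally have B'A: "B' ** A = - (A ** B')" .
  have "D ** B' ** A = D ** (B' ** A)" by (simp add: matrix_mul_assoc)
  also have "\<dots> = - (D ** A ** B')" unfolding B'A by (simp add: mat2_uminus_mult matrix_mul_assoc)
  also have "\<dots> = A ** (D ** B')"
    using D(1) by (simp add: anticommuting_def mat2_uminus_mult matrix_mul_assoc)
  finally have "D ** B' \<in> commuting"
    using D(1) B'(1) SL2_mult by (simp add: anticommuting_def commuting_def)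
  moreover have "refl_const ((D ** B') ** B) = transl (D ** B') + refl_const B"
    using B calculation by (intro refl_const_mult) (auto simp: anticommuting_def commuting_def SL2_det)
  moreover have "(D ** B') ** B = D"
    by (metis B'(2) matrix_mul_assoc matrix_mul_rid)
  ultimately show "x \<in> (\<lambda>x. x + refl_const B) ` transl ` commuting"
    using D(2) by force
qed

abbreviation \<Gamma> where "\<Gamma> \<equiv> PSL2 R"
abbreviation \<gamma> where "\<gamma> \<equiv> {A, - A}"

section \<open>Orbits on the axis and the homeomorphism type of the quotient\<close>

lemma centralizer_orbit:
  "orbit (\<Gamma>\<lparr>carrier := centralizer \<Gamma> \<gamma>\<rparr>) PSL2_act p = {SL2_act B p | B. B \<in> commuting \<union> anticommuting}"
proof -
  have act: "PSL2_act {B, - B} = SL2_act B" if "B \<in> carrier (SL2 R)" for B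
    by (rule PSL2_act_eq[of _ R]) (use that in \<open>auto simp: carrier_PSL2\<close>)
  have "orbit (\<Gamma>\<lparr>carrier := centralizer \<Gamma> \<gamma>\<rparr>) PSL2_act p =
      {PSL2_act {B, - B} p | B. B \<in> commuting \<union> anticommuting}"
    using centralizer_PSL2[OF A_in] by (auto simp: orbit_def commuting_def anticommuting_def)
  also have "\<dots> = {SL2_act B p | B. B \<in> commuting \<union> anticommuting}"
    using act by (intro Collect_cong ex_cong1) (auto simp: commuting_def anticommuting_def)
  finally show ?thesis .
qed

definition coord_orbit :: "real \<Rightarrow> real set" where
  "coord_orbit s = (\<lambda>x. s + x) ` transl ` commuting \<union> (\<lambda>x. x - s) ` refl_const ` anticommuting"

lemma orbit_axis_point:
  "orbit (\<Gamma>\<lparr>carrier := centralizer \<Gamma> \<gamma>\<rparr>) PSL2_act (axis_point s) = axis_point ` coord_orbit s"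
proof -
  have "SL2_act B (axis_point s) = axis_point (s + transl B)" if "B \<in> commuting" for B
    using that by (intro SL2_act_commute) (auto simp: commuting_def SL2_det)
  moreover have "SL2_act B (axis_point s) = axis_point (refl_const B - s)" if "B \<in> anticommuting" for B
    using that by (intro SL2_act_anticommute) (auto simp: anticommuting_def SL2_det)
  ultimately show ?thesis
    unfolding centralizer_orbit coord_orbit_def image_Un image_image by (auto simp: image_iff) metis+
qed

text \<open>Reduces the topology to arithmetic: it suffices to give a quotient map of the real line
  whose fibres are the orbits in the coordinate \<open>axis_coord\<close>.\<close>

lemma axis_quotient_homeomorphic:
  assumes f: "quotient_map euclidean Y f" and eq: "\<And>s s'. coord_orbit s = coord_orbit s' \<longleftrightarrow> f s = f s'"
  shows "axis_quotient \<Gamma> \<gamma> homeomorphic_space Y"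
proof -
  have "\<gamma> \<in> carrier \<Gamma>" using A_in by (auto simp: carrier_PSL2)
  then have "PSL2_act \<gamma> = SL2_act A" by (rule PSL2_act_eq) simp
  then have "invariants hyp3 PSL2_act \<gamma> = rot_axis"
    by (auto simp: invariants_def rot_axis_def)
  moreover have "rot_axis \<subseteq> hyp3" by (auto simp: rot_axis_def)
  ultimately have eq_top: "axis_quotient \<Gamma> \<gamma> = quotient_topology (top_of_set rot_axis) (orbit (\<Gamma>\<lparr>carrier := centralizer \<Gamma> \<gamma>\<rparr>) PSL2_act)"
    by (simp add: axis_quotient_def orbit_space_def hyp3_topology_eq subtopology_subtopology Int_absorb1)
  have inj: "inj axis_point"
    by (metis axis_coord_point injI)
  have "f (axis_coord p) = f (axis_coord p') \<longleftrightarrow>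
      orbit (\<Gamma>\<lparr>carrier := centralizer \<Gamma> \<gamma>\<rparr>) PSL2_act p = orbit (\<Gamma>\<lparr>carrier := centralizer \<Gamma> \<gamma>\<rparr>) PSL2_act p'"
    if "p \<in> rot_axis" "p' \<in> rot_axis" for p p'
    using orbit_axis_point[of "axis_coord p"] orbit_axis_point[of "axis_coord p'"] eq inj_image_eq_iff[OF inj]
    by (simp add: axis_point_coord that)
  then show ?thesis
    unfolding eq_top
    using quotient_map_compose[OF homeomorphic_map_axis_coord[unfolded homeomorphic_map_def, THEN conjunct1] f]
    by (intro homeomorphic_space_quotient_maps[OF quotient_map_quotient_topology]) auto
qed

lemma axis_quotient_circle:
  assumes "anticommuting = {}"
  shows "axis_quotient \<Gamma> \<gamma> homeomorphic_space top_of_set (sphere (0::complex) 1)"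
proof -
  obtain L where L: "L > 0" "transl ` commuting = {of_int k * L | k :: int. True}"
    using translation_lattice .
  have orb: "coord_orbit s = {s + of_int k * L | k :: int. True}" for s
    using assms L(2) by (auto simp: coord_orbit_def)
  have "coord_orbit s = coord_orbit s' \<longleftrightarrow> cis (2 * pi * s / L) = cis (2 * pi * s' / L)" for s s'
  proof -
    have "cis (2 * pi * s / L) = cis (2 * pi * s' / L) \<longleftrightarrow> (\<exists>k::int. s = s' + of_int k * L)"
    proof -
      have "2 * pi * s / L = 2 * pi * s' / L + 2 * pi * of_int k \<longleftrightarrow> s = s' + of_int k * L" for k :: int
      proof -
        have "2 * pi * s' / L + 2 * pi * of_int k = 2 * pi * (s' + of_int k * L) / L"
          using L(1) by (simp add: field_simps)
        then show ?thesis using L(1) by auto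
      qed
      then show ?thesis unfolding cis_eq_iff by simp
    qed
    also have "\<dots> \<longleftrightarrow> coord_orbit s = coord_orbit s'"
    proof
      assume "\<exists>k::int. s = s' + of_int k * L"
      then obtain k :: int where k: "s = s' + of_int k * L" by blast
      have "s + of_int j * L = s' + of_int (k + j) * L" "s' + of_int j * L = s + of_int (j - k) * L" for j
        unfolding k by (simp_all add: algebra_simps)
      then show "coord_orbit s = coord_orbit s'" unfolding orb by blast
    next
      assume "coord_orbit s = coord_orbit s'"
      moreover have "s \<in> coord_orbit s" unfolding orb by (auto intro: exI[of _ 0])
      ultimately show "\<exists>k::int. s = s' + of_int k * L" unfolding orb by blast
    qed
    finally show ?thesis by blast
  qed
  then show ?thesis
    by (rule axis_quotient_homeomorphic[OF quotient_map_circle[OF L(1)]])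
qed

lemma axis_quotient_interval:
  assumes "anticommuting \<noteq> {}"
  shows "axis_quotient \<Gamma> \<gamma> homeomorphic_space top_of_set {0..1::real}"
proof -
  obtain L where L: "L > 0" "transl ` commuting = {of_int k * L | k :: int. True}"
    using translation_lattice .
  obtain B where "B \<in> anticommuting" using assms by blast
  define \<sigma> where "\<sigma> = refl_const B"
  have refl: "refl_const ` anticommuting = {\<sigma> + of_int k * L | k :: int. True}"
    unfolding refl_consts[OF \<open>B \<in> anticommuting\<close>] L(2) \<sigma>_def by auto
  have orb: "coord_orbit s = {s + of_int k * L | k :: int. True} \<union> {\<sigma> - s + of_int k * L | k :: int. True}" for s
    unfolding coord_orbit_def refl L(2) by (auto simp: image_iff algebra_simps; metis)
  have mem: "x \<in> coord_orbit s \<longleftrightarrow> (\<exists>k::int. x = s + of_int k * L \<or> x = \<sigma> - s + of_int k * L)" for x s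
    unfolding orb by auto
  have sym: "s' \<in> coord_orbit s" if "s \<in> coord_orbit s'" for s s'
  proof -
    obtain k :: int where "s = s' + of_int k * L \<or> s = \<sigma> - s' + of_int k * L" using \<open>s \<in> coord_orbit s'\<close> mem by blast
    then have "s' = s + of_int (- k) * L \<or> s' = \<sigma> - s + of_int k * L" by auto
    then show ?thesis unfolding mem by blast
  qed
  have trans: "coord_orbit s \<subseteq> coord_orbit s'" if "s \<in> coord_orbit s'" for s s'
  proof
    fix x assume "x \<in> coord_orbit s"
    then obtain j :: int where j: "x = s + of_int j * L \<or> x = \<sigma> - s + of_int j * L" using mem by blast
    obtain k :: int where k: "s = s' + of_int k * L \<or> s = \<sigma> - s' + of_int k * L" using \<open>s \<in> coord_orbit s'\<close> mem by blast
    have "x = s' + of_int (k + j) * L \<or> x = \<sigma> - s' + of_int (k + j) * L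
        \<or> x = \<sigma> - s' + of_int (j - k) * L \<or> x = s' + of_int (j - k) * L"
      using j k by (auto simp: algebra_simps)
    then show "x \<in> coord_orbit s'" unfolding mem by blast
  qed
  \<comment> \<open>The fixed point of the reflection sending \<open>s\<close> to
    \<open>\<sigma> - s\<close>; a cosine centred there is invariant under it.\<close>
  define c where "c = \<sigma> / 2"
  have "coord_orbit s = coord_orbit s' \<longleftrightarrow>
      (1 + cos (2 * pi * (s - c) / L)) / 2 = (1 + cos (2 * pi * (s' - c) / L)) / 2" for s s'
  proof -
    have "coord_orbit s = coord_orbit s' \<longleftrightarrow> s \<in> coord_orbit s'"
    proof
      have "s \<in> coord_orbit s" unfolding mem by (auto intro: exI[of _ 0])
      then show "coord_orbit s = coord_orbit s' \<Longrightarrow> s \<in> coord_orbit s'" by simp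
    qed (use sym trans in blast)
    also have "\<dots> \<longleftrightarrow> cos (2 * pi * (s - c) / L) = cos (2 * pi * (s' - c) / L)"
    proof -
      have "2 * pi * (s - c) / L = 2 * pi * (s' - c) / L + 2 * pi * of_int k \<longleftrightarrow> s = s' + of_int k * L" for k :: int
      proof -
        have "2 * pi * (s' - c) / L + 2 * pi * of_int k = 2 * pi * (s' - c + of_int k * L) / L"
          using L(1) by (simp add: field_simps)
        then show ?thesis using L(1) by auto
      qed
      moreover have "2 * pi * (s - c) / L = - (2 * pi * (s' - c) / L) + 2 * pi * of_int k \<longleftrightarrow> s = \<sigma> - s' + of_int k * L" for k :: int
      proof -
        have "- (2 * pi * (s' - c) / L) + 2 * pi * of_int k = 2 * pi * (c - s' + of_int k * L) / L"
          using L(1) by (simp add: field_simps)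
        then show ?thesis using L(1) by (auto simp: c_def)
      qed
      ultimately show ?thesis unfolding cos_eq_cos_iff mem by simp
    qed
    finally show ?thesis by simp
  qed
  then show ?thesis
    by (rule axis_quotient_homeomorphic[OF quotient_map_interval[OF L(1)]])
qed

section \<open>Anticommuting matrices and Klein four-groups\<close>

text \<open>In the eigenbasis of \<open>A\<close> such a matrix is diagonal. Unless it is
  \<open>mat 1\<close> or \<open>- mat 1\<close> it has trace 0, which leaves only
  \<open>diag_i\<close> and its negative.\<close>

lemma commuting_involution:
  assumes "B \<in> commuting" "B ** B = mat 1 \<or> B ** B = - mat 1"
  shows "B \<in> {mat 1, - mat 1, A, - A}"
proof (cases "B = mat 1 \<or> B = - mat 1")
  case False
  have det': "det B = 1" and com: "B ** A = A ** B"
    using assms(1) by (auto simp: commuting_def SL2_det)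
  have "B $ 2 $ 2 = - B $ 1 $ 1"
    using mat2_order_two[OF det'] assms(2) False by blast
  define D where "D = Q ** B ** P"
  have "trace D = trace B"
    unfolding D_def by (metis PQ(1) matrix_mul_assoc matrix_mul_rid trace_mul_sym)
  then have tr: "D $ 2 $ 2 = - D $ 1 $ 1"
    using \<open>B $ 2 $ 2 = - B $ 1 $ 1\<close> by (simp add: trace_def sum_2 add_eq_0_iff)
  have off: "D $ 1 $ 2 = 0" "D $ 2 $ 1 = 0" "D $ 1 $ 1 * D $ 2 $ 2 = 1"
    using conj_commute[OF com] conj_commute_nonzero(1)[OF det' com] by (simp_all add: D_def)
  then have "(D $ 1 $ 1)\<^sup>2 = \<i>\<^sup>2" using tr by (simp add: power2_eq_square) (metis minus_minus)
  then have "D $ 1 $ 1 = \<i> \<or> D $ 1 $ 1 = - \<i>" by (simp only: power2_eq_iff)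
  then have "D = diag_i \<or> D = - diag_i" using tr off by (auto simp: mat2_eq_iff)
  moreover have conj_back: "P ** (Q ** C ** P) ** Q = C" for C
    by (metis PQ(1) matrix_mul_assoc matrix_mul_lid matrix_mul_rid)
  ultimately have "B = A \<or> B = - A"
    using conj_back[of B] conj_back[of A] unfolding D_def[symmetric] diag by (auto simp: mat2_uminus_mult)
  then show ?thesis by auto
qed auto

text \<open>The conjugate is antidiagonal, so the trace is 0 and the square is minus the identity by
  Cayley-Hamilton. Its upper left entry 0 separates it from the four listed matrices.\<close>

lemma anticommuting_involution:
  assumes "B \<in> anticommuting"
  shows "B ** B = - mat 1" "B \<notin> {mat 1, - mat 1, A, - A}"
proof -
  have det': "det B = 1" and anti: "B ** A = - (A ** B)"
    using assms by (auto simp: anticommuting_def SL2_det)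
  have off: "(Q ** B ** P) $ 1 $ 1 = 0" "(Q ** B ** P) $ 2 $ 2 = 0"
    using conj_anticommute[OF anti] .
  have "trace (Q ** B ** P) = trace B"
    by (metis PQ(1) matrix_mul_assoc matrix_mul_rid trace_mul_sym)
  then have tr: "B $ 2 $ 2 = - B $ 1 $ 1"
    using off by (simp add: trace_def sum_2 add_eq_0_iff2)
  have "B $ 1 $ 2 * B $ 2 $ 1 = B $ 1 $ 1 * B $ 2 $ 2 - det B"
    by (simp add: det_2)
  then show "B ** B = - mat 1"
    unfolding det' tr by (simp add: mat2_eq_iff mat2_mult_component mat2_one_nth tr mult.commute)
  have "(Q ** A ** P) $ 1 $ 1 = \<i>" "(Q ** - A ** P) $ 1 $ 1 = - \<i>"
    "(Q ** mat 1 ** P) $ 1 $ 1 = 1" "(Q ** - mat 1 ** P) $ 1 $ 1 = - 1"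
    by (simp_all add: diag mat2_uminus_mult PQ mat2_one_nth)
  then show "B \<notin> {mat 1, - mat 1, A, - A}"
    using off(1) by auto
qed

text \<open>A Klein four-group around \<open>\<gamma>\<close> amounts to a second involution
  commuting with it. Its lift commutes or anticommutes with \<open>A\<close>, and the commuting case
  yields only the identity and \<open>\<gamma>\<close>.\<close>

lemma anticommuting_iff_klein_four:
  "(\<exists>H. subgroup H \<Gamma> \<and> generate \<Gamma> {\<gamma>} \<subseteq> H \<and>
      \<Gamma>\<lparr>carrier := H\<rparr> \<cong> integer_mod_group 2 \<times>\<times> integer_mod_group 2) \<longleftrightarrow> anticommuting \<noteq> {}"
proof -
  interpret \<Gamma>: group \<Gamma> by (rule group_PSL2) (use ring_R in auto)
  have AA: "A ** A = - mat 1"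
  proof -
    have "A = P ** diag_i ** Q"
      unfolding diag[symmetric] by (metis PQ(1) matrix_mul_assoc matrix_mul_lid matrix_mul_rid)
    moreover have "diag_i ** diag_i = - mat 1"
      by (simp add: mat2_eq_iff mat2_mult_component mat2_one_nth)
    ultimately have "A ** A = P ** (- mat 1) ** Q"
      by (metis PQ(2) matrix_mul_assoc matrix_mul_rid)
    then show ?thesis by (simp add: mat2_uminus_mult PQ)
  qed
  have \<gamma>: "\<gamma> \<in> carrier \<Gamma>" "\<gamma> \<noteq> \<one>\<^bsub>\<Gamma>\<^esub>" "\<gamma> \<otimes>\<^bsub>\<Gamma>\<^esub> \<gamma> = \<one>\<^bsub>\<Gamma>\<^esub>"
  proof -
    show "\<gamma> \<in> carrier \<Gamma>" using A_in by (auto simp: carrier_PSL2)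
    show "\<gamma> \<noteq> \<one>\<^bsub>\<Gamma>\<^esub>"
      using A_trace by (auto simp: PSL2_one pm_eq_iff mat2_uminus_mult mat2_eq_iff mat2_one_nth)
    show "\<gamma> \<otimes>\<^bsub>\<Gamma>\<^esub> \<gamma> = \<one>\<^bsub>\<Gamma>\<^esub>"
      unfolding PSL2_mult AA PSL2_one by auto
  qed
  have ex: "(\<exists>x\<in>carrier \<Gamma>. \<phi> x) \<longleftrightarrow> (\<exists>B\<in>carrier (SL2 R). \<phi> {B, - B})" for \<phi>
    unfolding carrier_PSL2 by blast
  have "(\<exists>x\<in>carrier \<Gamma>. x \<noteq> \<one>\<^bsub>\<Gamma>\<^esub> \<and> x \<noteq> \<gamma> \<and> x \<otimes>\<^bsub>\<Gamma>\<^esub> x = \<one>\<^bsub>\<Gamma>\<^esub> \<and> x \<otimes>\<^bsub>\<Gamma>\<^esub> \<gamma> = \<gamma> \<otimes>\<^bsub>\<Gamma>\<^esub> x)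
      \<longleftrightarrow> (\<exists>B\<in>carrier (SL2 R). B \<notin> {mat 1, - mat 1, A, - A} \<and> (B ** B = mat 1 \<or> B ** B = - mat 1)
            \<and> (B ** A = A ** B \<or> B ** A = - (A ** B)))"
    unfolding ex PSL2_mult PSL2_one pm_eq_iff by (intro bex_cong) auto
  also have "\<dots> \<longleftrightarrow> anticommuting \<noteq> {}"
  proof
    assume "anticommuting \<noteq> {}"
    then obtain B where B: "B \<in> anticommuting" by blast
    then show "\<exists>B\<in>carrier (SL2 R). B \<notin> {mat 1, - mat 1, A, - A} \<and> (B ** B = mat 1 \<or> B ** B = - mat 1)
            \<and> (B ** A = A ** B \<or> B ** A = - (A ** B))"
      using anticommuting_involution[OF B] by (intro bexI[of _ B]) (auto simp: anticommuting_def)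
  next
    assume "\<exists>B\<in>carrier (SL2 R). B \<notin> {mat 1, - mat 1, A, - A} \<and> (B ** B = mat 1 \<or> B ** B = - mat 1)
            \<and> (B ** A = A ** B \<or> B ** A = - (A ** B))"
    then obtain B where B: "B \<in> carrier (SL2 R)" "B \<notin> {mat 1, - mat 1, A, - A}"
        "B ** B = mat 1 \<or> B ** B = - mat 1" "B ** A = A ** B \<or> B ** A = - (A ** B)"
      by blast
    then have "B \<notin> commuting" using commuting_involution by blast
    then have "B \<in> anticommuting" using B by (simp add: commuting_def anticommuting_def)
    then show "anticommuting \<noteq> {}" by blast
  qed
  finally show ?thesis
    using \<Gamma>.in_klein_four_subgroup_iff[OF \<gamma>] by simp
qed

end

section \<open>From the unit group hypothesis to the theorem\<close>

text \<open>A square root \<open>a\<close> of -1 would be a unit with inverse \<open>- a\<close>,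
  different from 1 and -1; for \<open>m = 1\<close> the ring contains \<open>\<i>\<close>.\<close>

lemma unit_group_excludes_Gauss:
  assumes "squarefree m" "unit_group (ring_of_integers (imag_quadratic_field m)) = {1, -1}"
  shows "\<And>a. a \<in> ring_of_integers (imag_quadratic_field m) \<Longrightarrow> a * a \<noteq> -1" "m \<noteq> 1"
proof -
  define R where "R = ring_of_integers (imag_quadratic_field m)"
  show no_i: "a * a \<noteq> -1" if "a \<in> ring_of_integers (imag_quadratic_field m)" for a
  proof
    assume a: "a * a = -1"
    have "- a \<in> R" using ring_of_integers_uminus[OF assms(1) R_def] that by (simp add: R_def)
    then have "a \<in> unit_group R"
      using that a by (auto simp: unit_group_def R_def intro!: bexI[of _ "- a"])
    then have "a = 1 \<or> a = -1" using assms(2) by (simp add: R_def)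
    then show False using a by auto
  qed
  show "m \<noteq> 1"
  proof
    assume "m = 1"
    then have "\<i> \<in> R" using ring_of_integers_sqrt[OF assms(1) R_def, of 1] by simp
    then show False using no_i[of \<i>] by (simp add: R_def)
  qed
qed

theorem theorem21:
  fixes m :: nat and \<Gamma> :: "(complex^2^2) set monoid" and \<gamma> :: "(complex^2^2) set"
  assumes "m > 0" and "squarefree m"
    and "unit_group (ring_of_integers (imag_quadratic_field m)) = {1, -1}"
    and "\<Gamma> = bianchi_group m"
    and "\<gamma> \<in> carrier \<Gamma>" and "group.ord \<Gamma> \<gamma> = 2"
  shows "((\<exists>H. subgroup H \<Gamma> \<and> generate \<Gamma> {\<gamma>} \<subseteq> H \<and>
               \<Gamma>\<lparr>carrier := H\<rparr> \<cong> integer_mod_group 2 \<times>\<times> integer_mod_group 2)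
            \<longrightarrow> axis_quotient \<Gamma> \<gamma> homeomorphic_space top_of_set {0..1::real}) \<and>
         (\<not> (\<exists>H. subgroup H \<Gamma> \<and> generate \<Gamma> {\<gamma>} \<subseteq> H \<and>
               \<Gamma>\<lparr>carrier := H\<rparr> \<cong> integer_mod_group 2 \<times>\<times> integer_mod_group 2)
            \<longrightarrow> axis_quotient \<Gamma> \<gamma> homeomorphic_space top_of_set (sphere (0::complex) 1))"
proof -
  define R where "R = ring_of_integers (imag_quadratic_field m)"
  have \<Gamma>: "\<Gamma> = PSL2 R" using assms(4) by (simp add: bianchi_group_def R_def)
  have ring: "1 \<in> R" "\<And>x y. x \<in> R \<Longrightarrow> y \<in> R \<Longrightarrow> x + y \<in> R"
    "\<And>x y. x \<in> R \<Longrightarrow> y \<in> R \<Longrightarrow> x * y \<in> R" "\<And>x. x \<in> R \<Longrightarrow> - x \<in> R"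
    using ring_of_integers_of_int[OF assms(2) R_def, of 1] ring_of_integers_add[OF assms(2) R_def]
      ring_of_integers_mult[OF assms(2) R_def] ring_of_integers_uminus[OF assms(2) R_def] by simp_all
  obtain A where A: "A \<in> carrier (SL2 R)" and \<gamma>: "\<gamma> = {A, - A}"
    using assms(5) unfolding \<Gamma> carrier_PSL2 by blast
  have "\<gamma> \<noteq> \<one>\<^bsub>\<Gamma>\<^esub>" "\<gamma> \<otimes>\<^bsub>\<Gamma>\<^esub> \<gamma> = \<one>\<^bsub>\<Gamma>\<^esub>"
    using group.ord_eq_two_iff[OF group_PSL2[OF ring] assms(5)[unfolded \<Gamma>]] assms(6) by (simp_all add: \<Gamma>)
  then have "A \<noteq> mat 1" "A \<noteq> - mat 1" "A ** A = mat 1 \<or> A ** A = - mat 1"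
    unfolding \<Gamma> \<gamma> PSL2_mult PSL2_one pm_eq_iff by auto
  moreover have det: "det A = 1" and entries: "\<And>i j. A $ i $ j \<in> R" using A by (auto simp: SL2_def)
  ultimately have tr: "A $ 2 $ 2 = - A $ 1 $ 1" by (intro mat2_order_two)
  \<comment> \<open>Otherwise \<open>A\<close> would be triangular with trace 0 and determinant 1,
    and its upper left entry would be a square root of -1 in \<open>R\<close>.\<close>
  have "A $ 2 $ 1 \<noteq> 0"
  proof
    assume "A $ 2 $ 1 = 0"
    then have "- (A $ 1 $ 1 * A $ 1 $ 1) = 1" using det tr by (simp add: det_2)
    then have "A $ 1 $ 1 * A $ 1 $ 1 = - 1" by (metis minus_minus)
    then show False using unit_group_excludes_Gauss(1)[OF assms(2,3)] entries[of 1 1] by (simp add: R_def)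
  qed
  then obtain P Q where "det P = 1" "det Q = 1" "P ** Q = mat 1" "Q ** P = mat 1" "Q ** A ** P = diag_i"
    using mat2_diagonalise[OF tr det] by blast
  then interpret bianchi_rotation A P Q m R
    using det assms(2) unit_group_excludes_Gauss(2)[OF assms(2,3)] A tr by unfold_locales (auto simp: R_def)
  show ?thesis
    unfolding \<Gamma> \<gamma> anticommuting_iff_klein_four
    using axis_quotient_circle axis_quotient_interval by blast
qed

end
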